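(* Let $c\in(1,\tfrac{149}{87})$ be fixed. For every $\varepsilon>0$, the inequality $$ \sum_{p\le x^c}\log p\sum_{\substack{n\le x\\ p\,\mid\,\lfloor n^c\rfloor}}1 >(c-\varepsilon)\,x\log x $$ holds for all sufficiently large $x$ (in terms of $c$ and $\varepsilon$), where $p$ runs over primes and $n$ over natural numbers.
   Context: $\lfloor t\rfloor$ is the integer part of the real number $t$. *)

theory Defs
  imports Complex_Main "HOL-Computational_Algebra.Primes"
begin

end

theory Submission
  imports Defs "HOL-Analysis.Harmonic_Numbers" "HOL-Real_Asymp.Real_Asymp"
begin

text \<open>
  Write \<open>m = \<lfloor>n\<^sup>c\<rfloor>\<close>. Exchanging the sums turns the left-hand side into the sum of \<open>ln (rad m)\<close> over
  \<open>n \<le> x\<close>, and \<open>rad m\<close> is close to \<open>m\<close> unless \<open>m\<close> has a square divisor \<open>d\<^sup>2\<close> with \<open>d \<ge> x\<^sup>\<delta>\<close>. So it suffices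
  that for \<open>X \<le> n \<le> 2X\<close> and \<open>d\<close> of size \<open>Y = X\<^sup>\<theta>\<close>, with \<open>\<theta>\<close> bounded away from \<open>0\<close>, the relation
  \<open>\<lfloor>n\<^sup>c\<rfloor> = a d\<^sup>2\<close> has at most \<open>X\<^sup>1\<^sup>-\<^sup>\<eta>\<close> solutions. This is a problem on integer points near a family of
  convex curves: \<open>a = n\<^sup>c / d\<^sup>2\<close> with parameter \<open>d\<close>, or \<open>n = (a d\<^sup>2)\<^sup>1\<^sup>/\<^sup>c\<close> with parameter \<open>a\<close>.

  Three consecutive integer points on a curve, if not too close together, span a triangle of small
  positive integral area. The two edge vectors almost determine the point and, since the first
  difference of the curve increases while the second one decreases along it, also the parameter.
  Counting pairs of integer vectors with a small determinant therefore bounds the number of points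
  on all curves together. The first family gives the exponent \<open>2c - 3 + \<theta>\<close> and the second one
  \<open>5c - 3 - 8\<theta>\<close>; one of the two is below \<open>1\<close> for every \<open>\<theta>\<close> as long as \<open>c < 12/7\<close>, and
  \<open>149/87 < 12/7\<close>.
\<close>

section \<open>Differences of powers\<close>

text \<open>The exponents come from a balance in U, the extent of a triple. Points that start no
  triple of extent at most U number, per curve, about the length of the abscissa range over U.
  Summed over all curves this has to stay below X^(1-eta), which fixes U. Triples then number about
  slope * U^2 * (curv * U^3), where curv * U^3 bounds the area; this is X^(2c-3+theta) for the first
  family and X^(5c-3-8 theta) for the second. The conditions theta < 4 - 2c and theta > (5c-4)/8
  overlap for c < 12/7. At c = 149/87 the overlap is about (0.5704, 0.5747), whence the cut at
  571/1000. Beyond theta = c - 1 the trivial count X^c / Y is enough. The obstacle is rounding: an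
  integer point lies only within delta of its curve, so an area is certainly positive only when the
  gaps exceed about sqrt (delta / curv). Closer points are counted separately, through the few
  places where the slope is near a given rational. In both families they contribute X^(1-theta) up
  to logarithms, which is one reason why theta must stay away from 0.\<close>

lemma powr_dyadic_bounds:
  fixes X z \<beta> :: real
  assumes "1 < \<beta>" "\<beta> < 2" "0 < X" "X \<le> z" "z \<le> 2 * X"
  shows "X powr (\<beta> - 1) \<le> z powr (\<beta> - 1)" "z powr (\<beta> - 1) \<le> 2 * X powr (\<beta> - 1)"
    "X powr (\<beta> - 2) / 2 \<le> z powr (\<beta> - 2)" "z powr (\<beta> - 2) \<le> X powr (\<beta> - 2)"
proof -
  show "X powr (\<beta> - 1) \<le> z powr (\<beta> - 1)"
    using assms by (intro powr_mono2) auto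
  have "z powr (\<beta> - 1) \<le> (2 * X) powr (\<beta> - 1)"
    using assms by (intro powr_mono2) auto
  also have "\<dots> = 2 powr (\<beta> - 1) * X powr (\<beta> - 1)"
    using assms by (simp add: powr_mult)
  also have "\<dots> \<le> 2 powr 1 * X powr (\<beta> - 1)"
    using assms by (intro mult_right_mono powr_mono) auto
  finally show "z powr (\<beta> - 1) \<le> 2 * X powr (\<beta> - 1)" by simp
  have "X powr (\<beta> - 2) / 2 = 2 powr (-1) * X powr (\<beta> - 2)"
    by (simp add: powr_minus)
  also have "\<dots> \<le> 2 powr (\<beta> - 2) * X powr (\<beta> - 2)"
    using assms by (intro mult_right_mono powr_mono) auto
  also have "\<dots> = (2 * X) powr (\<beta> - 2)"
    using assms by (simp add: powr_mult)
  also have "\<dots> \<le> z powr (\<beta> - 2)"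
    using assms by (intro powr_mono2') auto
  finally show "X powr (\<beta> - 2) / 2 \<le> z powr (\<beta> - 2)" .
  show "z powr (\<beta> - 2) \<le> X powr (\<beta> - 2)"
    using assms by (intro powr_mono2') auto
qed

lemma powr_mvt:
  fixes x y a :: real
  assumes "0 < x" "x < y"
  obtains z where "x < z" "z < y" "y powr a - x powr a = (y - x) * (a * z powr (a - 1))"
proof -
  have "\<exists>z>x. z < y \<and> y powr a - x powr a = (y - x) * (a * z powr (a - 1))"
    using assms by (intro MVT2) (auto intro!: derivative_eq_intros)
  with that show ?thesis by blast
qed

definition fst_diff :: "real \<Rightarrow> real \<Rightarrow> real \<Rightarrow> real" where
  "fst_diff \<beta> u x = (x + u) powr \<beta> - x powr \<beta>"

text \<open>The cross product of two consecutive chords with unequal steps. Without division by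
  \<open>u * v\<close> it becomes an integer once the two increments are rounded to
  integers.\<close>

definition snd_diff :: "real \<Rightarrow> real \<Rightarrow> real \<Rightarrow> real \<Rightarrow> real" where
  "snd_diff \<beta> u v x = u * fst_diff \<beta> v (x + u) - v * fst_diff \<beta> u x"

lemma fst_diff_bounds:
  fixes X x u \<beta> :: real
  assumes "1 < \<beta>" "\<beta> < 2" "0 < X" "X \<le> x" "x + u \<le> 2 * X" "0 < u"
  shows "\<beta> * X powr (\<beta> - 1) * u \<le> fst_diff \<beta> u x"
    and "fst_diff \<beta> u x \<le> 2 * \<beta> * X powr (\<beta> - 1) * u"
proof -
  have "0 < x" "x < x + u" using assms by auto
  then obtain z where z: "x < z" "z < x + u" "fst_diff \<beta> u x = (x + u - x) * (\<beta> * z powr (\<beta> - 1))"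
    unfolding fst_diff_def by (rule powr_mvt)
  have b: "X powr (\<beta> - 1) \<le> z powr (\<beta> - 1)" "z powr (\<beta> - 1) \<le> 2 * X powr (\<beta> - 1)"
    using powr_dyadic_bounds[of \<beta> X z] assms z by auto
  have "\<beta> * u * X powr (\<beta> - 1) \<le> \<beta> * u * z powr (\<beta> - 1)"
    "\<beta> * u * z powr (\<beta> - 1) \<le> \<beta> * u * (2 * X powr (\<beta> - 1))"
    using b assms by (intro mult_left_mono; simp)+
  thus "\<beta> * X powr (\<beta> - 1) * u \<le> fst_diff \<beta> u x"
    "fst_diff \<beta> u x \<le> 2 * \<beta> * X powr (\<beta> - 1) * u"
    using z by (simp_all add: mult_ac)
qed

lemma fst_diff_increase:
  fixes X x1 x2 u \<beta> :: real
  assumes "1 < \<beta>" "\<beta> < 2" "0 < X" "X \<le> x1" "x1 \<le> x2" "x2 + u \<le> 2 * X" "0 < u"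
  shows "\<beta> * (\<beta> - 1) * X powr (\<beta> - 2) / 2 * u * (x2 - x1) \<le> fst_diff \<beta> u x2 - fst_diff \<beta> u x1"
proof (cases "x1 = x2")
  case False
  hence lt: "x1 < x2" using assms by simp
  have "\<exists>z>x1. z < x2 \<and> fst_diff \<beta> u x2 - fst_diff \<beta> u x1
      = (x2 - x1) * (\<beta> * (z + u) powr (\<beta> - 1) - \<beta> * z powr (\<beta> - 1))"
    unfolding fst_diff_def using lt assms by (intro MVT2) (auto intro!: derivative_eq_intros)
  then obtain z where z: "x1 < z" "z < x2" "fst_diff \<beta> u x2 - fst_diff \<beta> u x1
      = (x2 - x1) * (\<beta> * (z + u) powr (\<beta> - 1) - \<beta> * z powr (\<beta> - 1))" by blast
  have "0 < z" "z < z + u" using assms z by auto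
  then obtain s where s: "z < s" "s < z + u"
      "(z + u) powr (\<beta> - 1) - z powr (\<beta> - 1) = (z + u - z) * ((\<beta> - 1) * s powr (\<beta> - 1 - 1))"
    by (rule powr_mvt)
  have b: "X powr (\<beta> - 2) / 2 \<le> s powr (\<beta> - 2)"
    using powr_dyadic_bounds(3)[of \<beta> X s] assms z s by auto
  have "(x2 - x1) * (\<beta> * (u * ((\<beta> - 1) * (X powr (\<beta> - 2) / 2))))
      \<le> (x2 - x1) * (\<beta> * (u * ((\<beta> - 1) * s powr (\<beta> - 2))))"
    using b assms by (intro mult_left_mono) auto
  also have "\<dots> = (x2 - x1) * (\<beta> * ((z + u) powr (\<beta> - 1) - z powr (\<beta> - 1)))"
    unfolding s(3) by simp
  also have "\<dots> = fst_diff \<beta> u x2 - fst_diff \<beta> u x1"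
    unfolding z(3) by (simp add: algebra_simps)
  finally show ?thesis by (simp add: mult_ac)
qed simp

text \<open>The expansion point may lie on either side of the target, because
  \<open>second_difference\<close> expands around the middle abscissa in both directions.\<close>

lemma powr_taylor2:
  fixes p q a :: real
  assumes "0 < p" "0 < q" "p \<noteq> q"
  obtains z where "min p q < z" "z < max p q"
    "q powr a = p powr a + a * p powr (a - 1) * (q - p) + a * (a - 1) * z powr (a - 2) / 2 * (q - p)\<^sup>2"
proof -
  define d where "d = (\<lambda>m::nat. if m = 0 then (\<lambda>t. t powr a) else if m = 1 then (\<lambda>t::real. a * t powr (a - 1))
      else (\<lambda>t. a * (a - 1) * t powr (a - 2)))"
  have "\<exists>t. (if q < p then q < t \<and> t < p else p < t \<and> t < q) \<and>
      q powr a = (\<Sum>m<2. (d m p / fact m) * (q - p)^m) + (d 2 t / fact 2) * (q - p)^2"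
  proof (rule Taylor[where a = "min p q" and b = "max p q"])
    show "\<forall>m t. m < 2 \<and> min p q \<le> t \<and> t \<le> max p q \<longrightarrow> (d m has_real_derivative d (Suc m) t) (at t)"
    proof (intro allI impI)
      fix m :: nat and t :: real
      assume "m < 2 \<and> min p q \<le> t \<and> t \<le> max p q"
      hence "0 < t" "m = 0 \<or> m = 1" using assms by auto
      thus "(d m has_real_derivative d (Suc m) t) (at t)"
        by (auto simp: d_def intro!: derivative_eq_intros)
    qed
  qed (use assms in \<open>auto simp: d_def\<close>)
  then obtain t where t: "if q < p then q < t \<and> t < p else p < t \<and> t < q"
      "q powr a = (\<Sum>m<2. (d m p / fact m) * (q - p)^m) + (d 2 t / fact 2) * (q - p)^2" by blast
  show ?thesis
    by (rule that[of t]) (use t assms in \<open>auto simp: d_def numeral_2_eq_2 split: if_splits\<close>)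
qed

text \<open>Around the middle point \<open>x + u\<close> the first-order terms of the two increments
  cancel in the cross product. The exponent is arbitrary: it is later \<beta> for the size and
  \<beta> - 1 for the derivative of \<open>snd_diff\<close>.\<close>

lemma second_difference:
  fixes x u v a :: real
  assumes "0 < x" "0 < u" "0 < v"
  obtains z1 z2 where "x < z1" "z1 < x + u" "x + u < z2" "z2 < x + u + v"
    "u * ((x + u + v) powr a - (x + u) powr a) - v * ((x + u) powr a - x powr a)
      = a * (a - 1) / 2 * (u * v) * (v * z2 powr (a - 2) + u * z1 powr (a - 2))"
proof -
  have p: "0 < x + u" "0 < x" "x + u \<noteq> x" "0 < x + u + v" "x + u \<noteq> x + u + v"
    using assms by auto
  obtain z1 where z1: "min (x + u) x < z1" "z1 < max (x + u) x" "x powr a = (x + u) powr a + a * (x + u) powr (a - 1) * (x - (x + u))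
      + a * (a - 1) * z1 powr (a - 2) / 2 * (x - (x + u))\<^sup>2"
    using p(1-3) by (rule powr_taylor2)
  obtain z2 where z2: "min (x + u) (x + u + v) < z2" "z2 < max (x + u) (x + u + v)"
      "(x + u + v) powr a = (x + u) powr a + a * (x + u) powr (a - 1) * (x + u + v - (x + u))
      + a * (a - 1) * z2 powr (a - 2) / 2 * (x + u + v - (x + u))\<^sup>2"
    using p(1,4,5) by (rule powr_taylor2)
  define k where "k = a * (x + u) powr (a - 1)"
  have 1: "(x + u) powr a - x powr a = k * u - a * (a - 1) * z1 powr (a - 2) / 2 * u\<^sup>2"
    using z1(3) by (simp add: k_def)
  have 2: "(x + u + v) powr a - (x + u) powr a = k * v + a * (a - 1) * z2 powr (a - 2) / 2 * v\<^sup>2"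
    using z2(3) by (simp add: k_def)
  show ?thesis
  proof (rule that[of z1 z2])
    show "u * ((x + u + v) powr a - (x + u) powr a) - v * ((x + u) powr a - x powr a)
      = a * (a - 1) / 2 * (u * v) * (v * z2 powr (a - 2) + u * z1 powr (a - 2))"
      unfolding 1 2 by (simp add: field_simps power2_eq_square)
  qed (use z1(1,2) z2(1,2) assms in auto)
qed

lemma snd_diff_bounds:
  fixes X x u v \<beta> :: real
  assumes "1 < \<beta>" "\<beta> < 2" "0 < X" "X \<le> x" "x + u + v \<le> 2 * X" "0 < u" "0 < v"
  shows "\<beta> * (\<beta> - 1) * X powr (\<beta> - 2) / 4 * (u * v * (u + v)) \<le> snd_diff \<beta> u v x"
    and "snd_diff \<beta> u v x \<le> \<beta> * (\<beta> - 1) * X powr (\<beta> - 2) / 2 * (u * v * (u + v))"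
proof -
  obtain z1 z2 where z: "x < z1" "z1 < x + u" "x + u < z2" "z2 < x + u + v"
    "snd_diff \<beta> u v x = \<beta> * (\<beta> - 1) / 2 * (u * v) * (v * z2 powr (\<beta> - 2) + u * z1 powr (\<beta> - 2))"
    unfolding snd_diff_def fst_diff_def
    by (rule second_difference[of x u v \<beta>]) (use assms in auto)
  let ?Q = "X powr (\<beta> - 2)"
  have b: "?Q / 2 \<le> z1 powr (\<beta> - 2)" "z1 powr (\<beta> - 2) \<le> ?Q"
    "?Q / 2 \<le> z2 powr (\<beta> - 2)" "z2 powr (\<beta> - 2) \<le> ?Q"
    using powr_dyadic_bounds(3,4)[of \<beta> X z1] powr_dyadic_bounds(3,4)[of \<beta> X z2] assms z by auto
  have "v * (?Q / 2) + u * (?Q / 2) \<le> v * z2 powr (\<beta> - 2) + u * z1 powr (\<beta> - 2)"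
    "v * z2 powr (\<beta> - 2) + u * z1 powr (\<beta> - 2) \<le> v * ?Q + u * ?Q"
    using b assms by (intro add_mono mult_left_mono; simp)+
  hence "\<beta> * (\<beta> - 1) / 2 * (u * v) * (v * (?Q / 2) + u * (?Q / 2)) \<le> snd_diff \<beta> u v x"
    "snd_diff \<beta> u v x \<le> \<beta> * (\<beta> - 1) / 2 * (u * v) * (v * ?Q + u * ?Q)"
    unfolding z(5) using assms by (intro mult_left_mono; simp)+
  moreover have "\<beta> * (\<beta> - 1) / 2 * (u * v) * (v * (?Q / 2) + u * (?Q / 2))
      = \<beta> * (\<beta> - 1) * ?Q / 4 * (u * v * (u + v))"
    "\<beta> * (\<beta> - 1) / 2 * (u * v) * (v * ?Q + u * ?Q) = \<beta> * (\<beta> - 1) * ?Q / 2 * (u * v * (u + v))"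
    by (simp_all add: field_simps)
  ultimately show "\<beta> * (\<beta> - 1) * ?Q / 4 * (u * v * (u + v)) \<le> snd_diff \<beta> u v x"
    "snd_diff \<beta> u v x \<le> \<beta> * (\<beta> - 1) * ?Q / 2 * (u * v * (u + v))"
    by (simp_all only:)
qed

text \<open>The derivative is \<beta> times the same cross product for the exponent \<beta> - 1, and
  its sign is that of (\<beta> - 1) * (\<beta> - 2) < 0.\<close>

lemma snd_diff_antimono:
  fixes x1 x2 u v \<beta> :: real
  assumes "1 < \<beta>" "\<beta> < 2" "0 < x1" "x1 \<le> x2" "0 < u" "0 < v"
  shows "snd_diff \<beta> u v x2 \<le> snd_diff \<beta> u v x1"
proof (rule DERIV_nonpos_imp_nonincreasing[OF assms(4)])
  fix x assume x: "x1 \<le> x" "x \<le> x2"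
  let ?D = "u * (\<beta> * (x + u + v) powr (\<beta> - 1) - \<beta> * (x + u) powr (\<beta> - 1))
      - v * (\<beta> * (x + u) powr (\<beta> - 1) - \<beta> * x powr (\<beta> - 1))"
  have "(snd_diff \<beta> u v has_real_derivative ?D) (at x)"
    unfolding snd_diff_def fst_diff_def using x assms by (auto intro!: derivative_eq_intros)
  moreover have "?D \<le> 0"
  proof -
    obtain z1 z2 where z: "x < z1" "z1 < x + u" "x + u < z2" "z2 < x + u + v"
      "u * ((x + u + v) powr (\<beta> - 1) - (x + u) powr (\<beta> - 1)) - v * ((x + u) powr (\<beta> - 1) - x powr (\<beta> - 1))
      = (\<beta> - 1) * (\<beta> - 1 - 1) / 2 * (u * v) * (v * z2 powr (\<beta> - 1 - 2) + u * z1 powr (\<beta> - 1 - 2))"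
      by (rule second_difference[of x u v "\<beta> - 1"]) (use assms x in auto)
    have "?D = \<beta> * (u * ((x + u + v) powr (\<beta> - 1) - (x + u) powr (\<beta> - 1))
        - v * ((x + u) powr (\<beta> - 1) - x powr (\<beta> - 1)))"
      by (simp add: algebra_simps)
    also have "\<dots> \<le> 0"
    proof -
      have "0 \<le> u * v * (v * z2 powr (\<beta> - 1 - 2) + u * z1 powr (\<beta> - 1 - 2))"
        using assms by simp
      moreover have "\<beta> * (\<beta> - 1) * (\<beta> - 1 - 1) / 2 \<le> 0"
        using assms by (simp add: mult_nonneg_nonpos)
      ultimately have "\<beta> * (\<beta> - 1) * (\<beta> - 1 - 1) / 2
          * (u * v * (v * z2 powr (\<beta> - 1 - 2) + u * z1 powr (\<beta> - 1 - 2))) \<le> 0"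
        by (rule mult_nonpos_nonneg[rotated])
      thus ?thesis unfolding z(5) by (simp add: mult.assoc)
    qed
    finally show ?thesis .
  qed
  ultimately show "\<exists>y. (snd_diff \<beta> u v has_real_derivative y) (at x) \<and> y \<le> 0" by blast
qed

section \<open>Spacing and residue classes\<close>

text \<open>Slots of width \<open>s\<close> measured from the minimum hold at most one element each.
  With \<open>s = 1\<close> this is the count of naturals in an interval.\<close>

lemma card_le_spacing:
  fixes A :: "nat set" and D s :: real
  assumes "finite A" "0 < s" "0 \<le> D"
    and diam: "\<And>x y. x \<in> A \<Longrightarrow> y \<in> A \<Longrightarrow> x < y \<Longrightarrow> real y - real x \<le> D"
    and gap: "\<And>x y. x \<in> A \<Longrightarrow> y \<in> A \<Longrightarrow> x < y \<Longrightarrow> s \<le> real y - real x"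
  shows "real (card A) \<le> D / s + 1"
proof (cases "A = {}")
  case False
  define m where "m = Min A"
  have m: "m \<in> A" "\<And>x. x \<in> A \<Longrightarrow> m \<le> x"
    using False assms(1) by (auto simp: m_def)
  define \<phi> where "\<phi> = (\<lambda>x. nat \<lfloor>(real x - real m) / s\<rfloor>)"
  have lt: "\<phi> x < \<phi> y" if "x \<in> A" "y \<in> A" "x < y" for x y
  proof -
    have "(real x - real m) / s + 1 = (real x - real m + s) / s" using assms(2) by (simp add: field_simps)
    also have "\<dots> \<le> (real y - real m) / s"
      using gap[OF that] assms(2) by (intro divide_right_mono) auto
    finally have "\<lfloor>(real x - real m) / s\<rfloor> + 1 \<le> \<lfloor>(real y - real m) / s\<rfloor>"
      by linarith
    moreover have "0 \<le> \<lfloor>(real x - real m) / s\<rfloor>"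
      using m(2)[OF that(1)] assms(2) by simp
    ultimately show ?thesis unfolding \<phi>_def by linarith
  qed
  have "inj_on \<phi> A"
    by (rule inj_onI) (metis lt linorder_neqE_nat less_irrefl)
  moreover have "\<phi> ` A \<subseteq> {..nat \<lfloor>D / s\<rfloor>}"
  proof safe
    fix x assume x: "x \<in> A"
    have "real x - real m \<le> D"
      using diam[OF m(1) x] m(2)[OF x] assms(3) by (cases "x = m") auto
    hence "(real x - real m) / s \<le> D / s" using assms(2) by (intro divide_right_mono) auto
    thus "\<phi> x \<le> nat \<lfloor>D / s\<rfloor>" unfolding \<phi>_def by (intro nat_mono floor_mono)
  qed
  ultimately have "card A \<le> card {..nat \<lfloor>D / s\<rfloor>}"
    by (intro card_inj_on_le) auto
  moreover have "real (nat \<lfloor>D / s\<rfloor>) \<le> D / s" using assms by simp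
  ultimately show ?thesis by simp
qed (use assms in auto)

text \<open>All the other qualifying elements lie above the smallest one, so only the last
  \<open>Suc k\<close> elements of \<open>A\<close> can qualify.\<close>

lemma card_few_above:
  fixes A :: "nat set"
  assumes "finite A"
  shows "card {x \<in> A. card {z \<in> A. x < z} \<le> k} \<le> Suc k"
proof (rule ccontr)
  let ?B = "{x \<in> A. card {z \<in> A. x < z} \<le> k}"
  assume "\<not> card ?B \<le> Suc k"
  hence c: "Suc k < card ?B" by simp
  hence ne: "?B \<noteq> {}" by force
  define m where "m = Min ?B"
  have fin: "finite ?B" using assms by simp
  have m: "m \<in> ?B" "\<And>x. x \<in> ?B \<Longrightarrow> m \<le> x"
    using Min_in[OF fin ne] Min_le[OF fin] by (auto simp: m_def)
  have "card (?B - {m}) \<le> card {z \<in> A. m < z}"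
    using assms m(2) by (intro card_mono) (auto simp: le_less)
  also have "\<dots> \<le> k" using m(1) by simp
  finally show False using c m(1) by (simp add: card_Diff_singleton)
qed

lemma ex_card_above:
  fixes Z :: "nat set"
  assumes "finite Z" "Suc k \<le> card Z"
  obtains a where "a \<in> Z" "k \<le> card {z \<in> Z. a < z}"
proof -
  have ne: "Z \<noteq> {}" using assms by auto
  have "card (Z - {Min Z}) \<le> card {z \<in> Z. Min Z < z}"
    using assms ne by (intro card_mono) (auto simp: order_less_le)
  moreover have "card (Z - {Min Z}) = card Z - 1" using assms ne by simp
  ultimately show ?thesis using assms ne by (intro that[of "Min Z"]) auto
qed

lemma ex_chain_four:
  fixes Z :: "nat set"
  assumes "finite Z" "4 \<le> card Z"
  obtains a b c d where "a \<in> Z" "b \<in> Z" "c \<in> Z" "d \<in> Z" "a < b" "b < c" "c < d"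
proof -
  obtain a where a: "a \<in> Z" "3 \<le> card {z \<in> Z. a < z}"
    using ex_card_above[of Z 3] assms by auto
  obtain b where b: "b \<in> {z \<in> Z. a < z}" "2 \<le> card {z \<in> {z \<in> Z. a < z}. b < z}"
    using ex_card_above[of "{z \<in> Z. a < z}" 2] a assms by auto
  obtain c where c: "c \<in> {z \<in> {z \<in> Z. a < z}. b < z}" "1 \<le> card {z \<in> {z \<in> {z \<in> Z. a < z}. b < z}. c < z}"
    using ex_card_above[of "{z \<in> {z \<in> Z. a < z}. b < z}" 1] b assms by auto
  obtain d where d: "d \<in> {z \<in> {z \<in> {z \<in> Z. a < z}. b < z}. c < z}"
    using ex_card_above[of "{z \<in> {z \<in> {z \<in> Z. a < z}. b < z}. c < z}" 0] c assms by auto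
  show ?thesis by (rule that[of a b c d]) (use a b c d in auto)
qed

lemma harm_le_ln:
  assumes "1 \<le> n"
  shows "harm n \<le> 1 + ln (real n)"
  using euler_mascheroni_sequence_decreasing[of 1 n] assms by (simp add: harm_def)

text \<open>Two solutions differ by a multiple of \<open>u div gcd u r\<close>. Since
  \<open>u <= U\<close>, the additive 1 of the spacing bound is at most the main term, hence the
  factor 2.\<close>

lemma card_residue_class:
  fixes u r t U :: nat
  assumes u: "1 \<le> u" "u \<le> U"
  shows "real (card {v \<in> {1..U}. u dvd r * v + t}) \<le> 2 * real U * real (gcd u r) / real u"
proof -
  define g where "g = gcd u r"
  have g: "0 < g" using u by (simp add: g_def)
  define q where "q = u div g"
  have q: "u = g * q" by (simp add: q_def g_def)
  with u have "0 < q" by (cases q) auto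
  note q = q this
  have "real (card {v \<in> {1..U}. u dvd r * v + t}) \<le> real U / real q + 1"
  proof (rule card_le_spacing)
    fix x y assume A: "x \<in> {v \<in> {1..U}. u dvd r * v + t}" "y \<in> {v \<in> {1..U}. u dvd r * v + t}" "x < y"
    have "u dvd (r * y + t) - (r * x + t)" using A by (intro dvd_diff_nat) auto
    also have "(r * y + t) - (r * x + t) = r * (y - x)" by (simp add: diff_mult_distrib2)
    finally have "g * q dvd g * ((r div g) * (y - x))"
      using q by (metis g_def dvd_mult_div_cancel gcd_dvd2 mult.assoc)
    hence "q dvd (r div g) * (y - x)" using g by simp
    moreover have "coprime q (r div g)"
      unfolding q_def g_def using u by (intro div_gcd_coprime) auto
    ultimately have "q dvd y - x" by (simp add: coprime_dvd_mult_right_iff)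
    hence "q \<le> y - x" using A(3) by (intro dvd_imp_le) auto
    thus "real q \<le> real y - real x" using A(3) by linarith
  qed (use q in auto)
  also have "real U / real q = real U * real g / real u"
    using q g by simp
  also have "real U * real g / real u + 1 \<le> 2 * (real U * real g / real u)"
  proof -
    have "1 * real u \<le> real g * real U" using u g by (intro mult_mono) auto
    hence "1 \<le> real U * real g / real u" using u by (simp add: field_simps)
    thus ?thesis by simp
  qed
  finally show ?thesis by (simp add: g_def)
qed

text \<open>Solvability forces g = \<open>gcd u r\<close> to divide \<open>t\<close>, so only one
  \<open>t\<close> in g contributes and the factor g lost in \<open>card_residue_class\<close> is
  regained. The weight \<open>1 + K / t\<close> anticipates the number of curves that share a
  triangle of doubled area \<open>t\<close>.\<close>

lemma sum_residue_class:
  fixes u r T U :: nat and K :: real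
  assumes u: "1 \<le> u" "u \<le> U" and "0 \<le> K"
  shows "(\<Sum>t=1..T. real (card {v \<in> {1..U}. u dvd r * v + t}) * (1 + K / real t))
    \<le> 2 * real U / real u * (real T + K * harm T)"
proof -
  define g where "g = gcd u r"
  have g: "0 < g" using u by (simp add: g_def)
  let ?c = "\<lambda>t. real (card {v \<in> {1..U}. u dvd r * v + t}) * (1 + K / real t)"
  have "(\<Sum>t=1..T. ?c t) = (\<Sum>t\<in>(\<lambda>s. g * s) ` {1..T div g}. ?c t)"
  proof (rule sum.mono_neutral_right)
    show "(*) g ` {1..T div g} \<subseteq> {1..T}"
      using g by (auto simp: less_eq_div_iff_mult_less_eq mult.commute)
    show "\<forall>t\<in>{1..T} - (*) g ` {1..T div g}. ?c t = 0"
    proof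
      fix t assume t: "t \<in> {1..T} - (*) g ` {1..T div g}"
      have "{v \<in> {1..U}. u dvd r * v + t} = {}"
      proof safe
        fix v assume "u dvd r * v + t"
        hence "g dvd r * v + t" unfolding g_def by (meson dvd_trans gcd_dvd1)
        moreover have "g dvd r * v" unfolding g_def by simp
        ultimately have "g dvd t" using dvd_add_right_iff by blast
        then obtain s where s: "t = g * s" by blast
        hence "s \<in> {1..T div g}" using t g by (auto simp: less_eq_div_iff_mult_less_eq mult.commute)
        thus "v \<in> {}" using s t by blast
      qed
      thus "?c t = 0" by (simp only: card.empty of_nat_0 mult_zero_left)
    qed
  qed auto
  also have "\<dots> = (\<Sum>s=1..T div g. ?c (g * s))"
    using g by (subst sum.reindex) (auto simp: inj_on_def)
  also have "\<dots> \<le> (\<Sum>s=1..T div g. 2 * real U * real g / real u * (1 + K / real (g * s)))"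
    unfolding g_def using assms by (intro sum_mono mult_right_mono card_residue_class) auto
  also have "\<dots> = (\<Sum>s=1..T div g. 2 * real U / real u * (real g + K * inverse (real s)))"
  proof (intro sum.cong refl)
    fix s assume "s \<in> {1..T div g}"
    hence "real g + K * inverse (real s) = real g * (1 + K / real (g * s))"
      using g by (simp add: field_simps)
    thus "2 * real U * real g / real u * (1 + K / real (g * s))
        = 2 * real U / real u * (real g + K * inverse (real s))" by simp
  qed
  also have "\<dots> = 2 * real U / real u * (real (T div g) * real g + K * harm (T div g))"
    unfolding sum_distrib_left[symmetric] harm_def sum.distrib by simp
  also have "\<dots> \<le> 2 * real U / real u * (real T + K * harm T)"
  proof (intro mult_left_mono add_mono)
    have "T div g * g \<le> T" by simp
    thus "real (T div g) * real g \<le> real T" by (simp flip: of_nat_mult)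
    show "(harm (T div g) :: real) \<le> harm T" by (intro harm_mono div_le_dividend)
  qed (use assms in auto)
  finally show ?thesis .
qed

section \<open>Integer points near a family of convex curves\<close>

lemma ln_ratio_le:
  fixes p s :: real
  assumes "0 < p" "0 \<le> s" "s \<le> p / 2"
  shows "ln ((p + s) / (p - s)) \<le> 4 * s / p"
proof -
  have ps: "p / 2 \<le> p - s" "0 < p - s" using assms by auto
  have "ln ((p + s) / (p - s)) \<le> (p + s) / (p - s) - 1"
    using ps assms by (intro ln_le_minus_one divide_pos_pos) auto
  also have "\<dots> = 2 * s / (p - s)" using ps by (simp add: field_simps)
  also have "\<dots> \<le> 2 * s / (p / 2)" using ps assms by (intro divide_left_mono) auto
  finally show ?thesis by simp
qed

text \<open>The curves are \<open>w y * x powr \<beta>\<close> with x between X and 2X.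
  \<open>B\<close> converts closeness of the logarithmic weights into closeness of the parameters;
  in both applications \<open>w\<close> is a power of \<open>y\<close>. The last condition keeps the
  error 2 \<delta> of a first difference below half its size, so that rounded increments are
  positive integers.\<close>

locale convex_family =
  fixes \<beta> M X W B \<delta> :: real and Ys :: "nat set" and w :: "nat \<Rightarrow> real"
  assumes beta: "1 < \<beta>" "\<beta> < 2" and M: "1 \<le> M" and X: "0 < X" and W: "0 < W" and B: "0 \<le> B"
    and delta: "0 < \<delta>" and fin_Ys: "finite Ys"
    and w_bounds: "\<And>y. y \<in> Ys \<Longrightarrow> W \<le> w y" "\<And>y. y \<in> Ys \<Longrightarrow> w y \<le> M * W"
    and w_sep: "\<And>y y'. y \<in> Ys \<Longrightarrow> y' \<in> Ys \<Longrightarrow> \<bar>real y - real y'\<bar> \<le> B * \<bar>ln (w y) - ln (w y')\<bar>"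
    and delta_le: "4 * \<delta> \<le> \<beta> * W * X powr (\<beta> - 1)"
begin

text \<open>\<open>slope\<close> and \<open>curv\<close> are the first and second derivative at X of
  the curve of weight \<open>W\<close>. They give the order of both derivatives for every curve of
  the family on [X, 2X], up to \<open>M\<close> and absolute constants.\<close>

definition slope :: real where "slope = \<beta> * W * X powr (\<beta> - 1)"

definition curv :: real where "curv = \<beta> * (\<beta> - 1) * W * X powr (\<beta> - 2)"

definition near :: "nat \<Rightarrow> nat \<Rightarrow> int" where
  "near y x = round (w y * real x powr \<beta>)"

definition pts :: "nat \<Rightarrow> nat set" where
  "pts y = {x. X \<le> real x \<and> real x \<le> 2 * X \<and> \<bar>w y * real x powr \<beta> - near y x\<bar> \<le> \<delta>}"

definition rise :: "nat \<Rightarrow> nat \<Rightarrow> nat \<Rightarrow> int" where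
  "rise y x u = near y (x + u) - near y x"

section \<open>Differences along a curve and their integer roundings\<close>

lemma slope_pos: "0 < slope" and curv_pos: "0 < curv"
  using beta W X by (auto simp: slope_def curv_def)

lemma ptsD: "x \<in> pts y \<Longrightarrow> X \<le> real x" "x \<in> pts y \<Longrightarrow> real x \<le> 2 * X"
  by (auto simp: pts_def)

lemma finite_pts [simp]: "finite (pts y)"
proof (rule finite_subset)
  show "pts y \<subseteq> {..nat \<lfloor>2 * X\<rfloor>}"
    by (auto simp: pts_def le_nat_floor)
qed simp

lemma w_pos: "y \<in> Ys \<Longrightarrow> 0 < w y"
  using w_bounds(1)[of y] W by linarith

lemma first_bounds:
  assumes "y \<in> Ys" "X \<le> real x" "real (x + u) \<le> 2 * X" "1 \<le> u"
  shows "slope * real u \<le> w y * fst_diff \<beta> (real u) (real x)"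
    and "w y * fst_diff \<beta> (real u) (real x) \<le> 2 * M * slope * real u"
proof -
  note fd = fst_diff_bounds[OF beta X, of "real x" "real u"]
  have nn: "0 \<le> \<beta> * X powr (\<beta> - 1) * real u" using beta by simp
  have "W * (\<beta> * X powr (\<beta> - 1) * real u) \<le> w y * fst_diff \<beta> (real u) (real x)"
    using fd(1) assms w_bounds(1) W nn by (intro mult_mono) (auto intro: less_imp_le[OF w_pos])
  thus "slope * real u \<le> w y * fst_diff \<beta> (real u) (real x)"
    by (simp add: slope_def mult_ac)
  have "w y * fst_diff \<beta> (real u) (real x) \<le> (M * W) * (2 * \<beta> * X powr (\<beta> - 1) * real u)"
    using fd assms w_bounds(2) W M nn by (intro mult_mono) auto
  thus "w y * fst_diff \<beta> (real u) (real x) \<le> 2 * M * slope * real u"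
    by (simp add: slope_def mult_ac)
qed

lemma first_increase:
  assumes "y \<in> Ys" "X \<le> real x1" "x1 \<le> x2" "real (x2 + u) \<le> 2 * X" "1 \<le> u"
  shows "curv / 2 * real u * (real x2 - real x1)
    \<le> w y * fst_diff \<beta> (real u) (real x2) - w y * fst_diff \<beta> (real u) (real x1)"
proof -
  have "W * (\<beta> * (\<beta> - 1) * X powr (\<beta> - 2) / 2 * real u * (real x2 - real x1))
      \<le> w y * (fst_diff \<beta> (real u) (real x2) - fst_diff \<beta> (real u) (real x1))"
    using fst_diff_increase[OF beta X, of "real x1" "real x2" "real u"] assms w_bounds(1) W beta
    by (intro mult_mono) (auto intro: less_imp_le[OF w_pos])
  also have "\<dots> = w y * fst_diff \<beta> (real u) (real x2) - w y * fst_diff \<beta> (real u) (real x1)"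
    by (rule right_diff_distrib)
  finally show ?thesis by (simp add: curv_def mult_ac)
qed

lemma second_bounds:
  assumes "y \<in> Ys" "X \<le> real x" "real (x + u + v) \<le> 2 * X" "1 \<le> u" "1 \<le> v"
  shows "curv / 4 * (real u * real v * (real u + real v)) \<le> w y * snd_diff \<beta> (real u) (real v) (real x)"
    and "w y * snd_diff \<beta> (real u) (real v) (real x) \<le> M * curv / 2 * (real u * real v * (real u + real v))"
proof -
  note sd = snd_diff_bounds[OF beta X, of "real x" "real u" "real v"]
  have nn: "0 \<le> \<beta> * (\<beta> - 1) * X powr (\<beta> - 2) / 4 * (real u * real v * (real u + real v))" using beta by simp
  have "W * (\<beta> * (\<beta> - 1) * X powr (\<beta> - 2) / 4 * (real u * real v * (real u + real v)))
      \<le> w y * snd_diff \<beta> (real u) (real v) (real x)"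
    using sd(1) assms w_bounds(1) W nn by (intro mult_mono) (auto intro: less_imp_le[OF w_pos])
  thus "curv / 4 * (real u * real v * (real u + real v)) \<le> w y * snd_diff \<beta> (real u) (real v) (real x)"
    by (simp add: curv_def mult_ac)
  have "0 \<le> snd_diff \<beta> (real u) (real v) (real x)"
    using sd(1) assms nn by force
  hence "w y * snd_diff \<beta> (real u) (real v) (real x)
      \<le> (M * W) * (\<beta> * (\<beta> - 1) * X powr (\<beta> - 2) / 2 * (real u * real v * (real u + real v)))"
    using sd(2) assms w_bounds(2) W M by (intro mult_mono) auto
  thus "w y * snd_diff \<beta> (real u) (real v) (real x) \<le> M * curv / 2 * (real u * real v * (real u + real v))"
    by (simp add: curv_def mult_ac)
qed

lemma rise_approx:
  assumes "x \<in> pts y" "x + u \<in> pts y"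
  shows "\<bar>w y * fst_diff \<beta> (real u) (real x) - rise y x u\<bar> \<le> 2 * \<delta>"
proof -
  have "w y * fst_diff \<beta> (real u) (real x) = w y * real (x + u) powr \<beta> - w y * real x powr \<beta>"
    by (simp add: fst_diff_def algebra_simps)
  moreover have "\<bar>w y * real (x + u) powr \<beta> - near y (x + u)\<bar> \<le> \<delta>" "\<bar>w y * real x powr \<beta> - near y x\<bar> \<le> \<delta>"
    using assms by (auto simp: pts_def)
  ultimately show ?thesis unfolding rise_def of_int_diff by linarith
qed

lemma rise_bounds:
  assumes "y \<in> Ys" "x \<in> pts y" "x + u \<in> pts y" "1 \<le> u"
  shows "slope * real u / 2 \<le> rise y x u" "rise y x u \<le> 3 * M * slope * real u" "1 \<le> rise y x u"
proof -
  have d: "4 * \<delta> \<le> slope * real u"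
  proof -
    have "slope * 1 \<le> slope * real u" using assms slope_pos by (intro mult_left_mono) auto
    thus ?thesis using delta_le by (simp add: slope_def)
  qed
  have d': "slope * real u \<le> M * (slope * real u)"
    using mult_right_mono[OF M, of "slope * real u"] slope_pos by simp
  note b = first_bounds[OF assms(1) ptsD(1)[OF assms(2)] ptsD(2)[OF assms(3)] assms(4)]
  note a = rise_approx[OF assms(2,3)]
  show *: "slope * real u / 2 \<le> rise y x u" using a b(1) d by linarith
  show "rise y x u \<le> 3 * M * slope * real u" using a b(2) d d' by (simp add: mult_ac)
  have "0 < slope * real u / 2" using slope_pos assms by simp
  thus "1 \<le> rise y x u" using * by linarith
qed

text \<open>Equal rises put the two exact first differences within 4 \<delta> of each other, while
  the first difference over \<open>u\<close> grows at rate at least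
  \<open>curv * u / 2\<close>.\<close>

lemma rise_window:
  assumes "y \<in> Ys" "x1 \<in> pts y" "x1 + u \<in> pts y" "x2 \<in> pts y" "x2 + u \<in> pts y" "1 \<le> u" "x1 < x2"
    and "rise y x1 u = rise y x2 u"
  shows "real x2 - real x1 \<le> 8 * \<delta> / curv / real u"
proof -
  have "curv / 2 * real u * (real x2 - real x1)
    \<le> w y * fst_diff \<beta> (real u) (real x2) - w y * fst_diff \<beta> (real u) (real x1)"
    using assms ptsD[OF assms(2)] ptsD[OF assms(5)] by (intro first_increase) auto
  also have "\<dots> \<le> 4 * \<delta>"
    using rise_approx[OF assms(2,3)] rise_approx[OF assms(4,5)] assms(8) by linarith
  finally show ?thesis using curv_pos assms(6) by (simp add: field_simps)
qed

section \<open>Points too close to a neighbour for the area argument\<close>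

definition clustered :: "nat \<Rightarrow> nat \<Rightarrow> nat set" where
  "clustered h y = {x \<in> pts y. \<exists>z\<in>pts y. z \<noteq> x \<and> z div h = x div h}"

definition cell :: "nat \<Rightarrow> nat \<Rightarrow> nat \<Rightarrow> nat set" where
  "cell h y b = {z \<in> pts y. z div h = b}"

text \<open>Within a cell of length \<open>h\<close> the smallest gap \<open>u\<close> bounds the number of points by \<open>2 h / u\<close>,
  and the pair realising it forces the slope of the curve to be close to a rational with denominator \<open>u\<close>.\<close>

definition tight_cells :: "nat \<Rightarrow> nat \<Rightarrow> nat \<Rightarrow> int \<Rightarrow> nat set" where
  "tight_cells h y u r = {p div h | p. p \<in> pts y \<and> p + u \<in> pts y \<and> rise y p u = r \<and>
     (\<forall>z\<in>cell h y (p div h). \<forall>z'\<in>cell h y (p div h). z < z' \<longrightarrow> u \<le> z' - z)}"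

text \<open>By \<open>rise_window\<close> the left ends of the gaps with given \<open>u\<close> and
  \<open>r\<close> lie in a window of length \<open>8 * \<delta> / curv / u\<close>, which meets few
  cells. Since u * h <= h^2 <= 36 * \<delta> / curv, the additive 2 costs at most 72 such units: 80
  = 8 + 72.\<close>

lemma card_tight_cells:
  assumes "y \<in> Ys" "1 \<le> u" "u \<le> h" "real h ^ 2 \<le> 36 * \<delta> / curv"
  shows "real (card (tight_cells h y u r)) \<le> 80 * \<delta> / curv / (real u * real h)"
proof -
  have h: "0 < h" using assms by simp
  have sub: "tight_cells h y u r \<subseteq> (\<lambda>x. x div h) ` pts y"
    by (auto simp: tight_cells_def)
  have "real (card (tight_cells h y u r)) \<le> (8 * \<delta> / curv / real u / real h + 1) / 1 + 1"
  proof (rule card_le_spacing)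
    show "finite (tight_cells h y u r)" using sub by (rule finite_subset) simp
    show "0 \<le> 8 * \<delta> / curv / real u / real h + 1" using delta curv_pos by simp
    fix b1 b2 assume "b1 \<in> tight_cells h y u r" "b2 \<in> tight_cells h y u r" and lt: "b1 < b2"
    then obtain p1 p2 where p: "b1 = p1 div h" "b2 = p2 div h" "p1 \<in> pts y" "p1 + u \<in> pts y"
      "p2 \<in> pts y" "p2 + u \<in> pts y" "rise y p1 u = rise y p2 u"
      by (auto simp: tight_cells_def)
    have "p1 < p2" using lt p(1,2) by (metis div_le_mono leD linorder_not_less)
    hence d: "real p2 - real p1 \<le> 8 * \<delta> / curv / real u"
      using rise_window[OF assms(1) p(3-6) assms(2)] p(7) by simp
    have "real b2 * real h \<le> real p2" "real p1 \<le> real b1 * real h + real h"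
      using p(1,2) h by (metis div_times_less_eq_dividend of_nat_le_iff of_nat_mult,
        metis add.commute dividend_less_times_div less_imp_le mult.commute of_nat_add of_nat_le_iff of_nat_mult)
    hence "(real b2 - real b1) * real h \<le> 8 * \<delta> / curv / real u + real h"
      using d by (simp add: algebra_simps)
    hence "real b2 - real b1 \<le> (8 * \<delta> / curv / real u + real h) / real h"
      using h by (simp only: pos_le_divide_eq of_nat_0_less_iff)
    thus "real b2 - real b1 \<le> 8 * \<delta> / curv / real u / real h + 1"
      using h by (simp only: add_divide_distrib) simp
    show "1 \<le> real b2 - real b1" using lt by simp
  qed simp
  also have "\<dots> \<le> 80 * \<delta> / curv / (real u * real h)"
  proof -
    have "real u * real h \<le> real h ^ 2"
      using assms by (simp add: power2_eq_square)
    hence "2 * (real u * real h) \<le> 72 * \<delta> / curv" using assms by simp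
    hence "2 \<le> 72 * \<delta> / curv / (real u * real h)"
      using h assms by (subst pos_le_divide_eq) auto
    moreover define q where "q = \<delta> / curv / (real u * real h)"
    have q: "8 * \<delta> / curv / real u / real h = 8 * q" "72 * \<delta> / curv / (real u * real h) = 72 * q"
      "80 * \<delta> / curv / (real u * real h) = 80 * q" by (simp_all add: q_def)
    ultimately show ?thesis unfolding q by simp
  qed
  finally show ?thesis .
qed

lemma card_tight_cell:
  assumes "1 \<le> u" "u \<le> h" "b \<in> tight_cells h y u r"
  shows "real (card (cell h y b)) \<le> 2 * real h / real u"
proof -
  have "0 < h" using assms by simp
  have "real (card (cell h y b)) \<le> real h / real u + 1"
  proof (rule card_le_spacing)
    fix z z' assume z: "z \<in> cell h y b" "z' \<in> cell h y b" "z < z'"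
    have "z' < (z' div h) * h + h" "(z div h) * h \<le> z"
      using dividend_less_div_times[OF \<open>0 < h\<close>, of z'] div_times_less_eq_dividend[of z h] by linarith+
    moreover have "z' div h * h = z div h * h" using z by (simp add: cell_def)
    ultimately have "z' \<le> z + h" by linarith
    thus "real z' - real z \<le> real h" by simp
    have "u \<le> z' - z" using z assms(3) by (auto simp: tight_cells_def)
    thus "real u \<le> real z' - real z" using z(3) by linarith
  qed (use assms in \<open>auto simp: cell_def\<close>)
  also have "\<dots> \<le> 2 * real h / real u"
    using assms by (simp add: field_simps)
  finally show ?thesis .
qed

text \<open>A clustered point is charged to the smallest gap \<open>u\<close> in its cell and to the
  rise \<open>r\<close> over that gap.\<close>

lemma clustered_subset:
  assumes "y \<in> Ys" "1 \<le> h"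
  shows "clustered h y \<subseteq>
    (\<Union>u\<in>{1..h}. \<Union>r\<in>{1..\<lfloor>3 * M * slope * real u\<rfloor>}. \<Union>b\<in>tight_cells h y u r. cell h y b)"
proof
  fix x assume x: "x \<in> clustered h y"
  define b where "b = x div h"
  obtain z where z: "x \<in> pts y" "z \<in> pts y" "z \<noteq> x" "z div h = x div h"
    using x by (auto simp: clustered_def)
  define P where "P = (\<lambda>u. 1 \<le> u \<and> (\<exists>p. p \<in> cell h y b \<and> p + u \<in> cell h y b))"
  have "\<exists>u. P u"
  proof (cases "x < z")
    case True
    thus ?thesis using z by (intro exI[of _ "z - x"]) (auto simp: P_def cell_def b_def intro!: exI[of _ x])
  next
    case False
    thus ?thesis using z by (intro exI[of _ "x - z"]) (auto simp: P_def cell_def b_def intro!: exI[of _ z])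
  qed
  define u where "u = (LEAST u. P u)"
  have "P u" unfolding u_def using \<open>\<exists>u. P u\<close> by (rule LeastI_ex)
  then obtain p where p: "1 \<le> u" "p \<in> cell h y b" "p + u \<in> cell h y b"
    by (auto simp: P_def)
  have min: "u \<le> z' - z" if "z \<in> cell h y b" "z' \<in> cell h y b" "z < z'" for z z'
    unfolding u_def by (rule Least_le) (use that in \<open>auto simp: P_def intro!: exI[of _ z]\<close>)
  have pp: "p \<in> pts y" "p + u \<in> pts y" "p div h = b" "(p + u) div h = b" using p by (auto simp: cell_def)
  have "u \<le> h"
  proof -
    have "0 < h" using assms by simp
    have "p + u < ((p + u) div h) * h + h" "(p div h) * h \<le> p"
      using dividend_less_div_times[OF \<open>0 < h\<close>, of "p + u"] div_times_less_eq_dividend[of p h] by linarith+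
    thus ?thesis using pp by simp
  qed
  moreover have "b \<in> tight_cells h y u (rise y p u)"
    unfolding tight_cells_def using pp min by blast
  moreover have "rise y p u \<in> {1..\<lfloor>3 * M * slope * real u\<rfloor>}"
    using rise_bounds[OF assms(1) pp(1,2) p(1)] by (simp add: le_floor_iff)
  moreover have "x \<in> cell h y b" using z by (simp add: cell_def b_def)
  ultimately show "x \<in> (\<Union>u\<in>{1..h}. \<Union>r\<in>{1..\<lfloor>3 * M * slope * real u\<rfloor>}. \<Union>b\<in>tight_cells h y u r. cell h y b)"
    using p(1) by (intro UN_I[of u] UN_I[of "rise y p u"] UN_I[of b]) auto
qed

lemma finite_tight_cells [simp]: "finite (tight_cells h y u r)"
  by (rule finite_subset[of _ "(\<lambda>x. x div h) ` pts y"]) (auto simp: tight_cells_def)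

text \<open>For fixed \<open>u\<close> and \<open>r\<close>, the number of cells times the number of
  points per cell is of order \<delta> / curv / u^2. There are O(slope * u) rises \<open>r\<close>,
  which leaves a harmonic sum over \<open>u\<close>. Cells of length 1 contain no cluster, so
  \<open>h = 1\<close> may violate the bound on \<open>h\<close>.\<close>

lemma card_clustered:
  assumes "y \<in> Ys" "1 \<le> h" "h = 1 \<or> real h ^ 2 \<le> 36 * \<delta> / curv"
  shows "real (card (clustered h y)) \<le> 480 * M * slope * (\<delta> / curv) * harm h"
proof (cases "h = 1")
  case True
  hence "clustered h y = {}" by (auto simp: clustered_def)
  thus ?thesis using M slope_pos curv_pos delta harm_nonneg[of h, where 'a = real] by simp
next
  case False
  hence h2: "real h ^ 2 \<le> 36 * \<delta> / curv" using assms by simp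
  let ?R = "\<lambda>u. {1..\<lfloor>3 * M * slope * real u\<rfloor>}"
  have inner: "real (card (\<Union>b\<in>tight_cells h y u r. cell h y b)) \<le> 160 * (\<delta> / curv) / (real u)\<^sup>2"
    if u: "u \<in> {1..h}" for u r
  proof -
    have "card (\<Union>b\<in>tight_cells h y u r. cell h y b) \<le> (\<Sum>b\<in>tight_cells h y u r. card (cell h y b))"
      by (rule card_UN_le) simp
    hence "real (card (\<Union>b\<in>tight_cells h y u r. cell h y b)) \<le> (\<Sum>b\<in>tight_cells h y u r. real (card (cell h y b)))"
      by (simp flip: of_nat_sum)
    also have "\<dots> \<le> (\<Sum>b\<in>tight_cells h y u r. 2 * real h / real u)"
      using u by (intro sum_mono card_tight_cell) auto
    also have "\<dots> = real (card (tight_cells h y u r)) * (2 * real h / real u)" by simp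
    also have "\<dots> \<le> 80 * \<delta> / curv / (real u * real h) * (2 * real h / real u)"
      using u assms h2 by (intro mult_right_mono card_tight_cells) auto
    also have "\<dots> = 160 * (\<delta> / curv) / (real u)\<^sup>2"
      using u by (simp add: power2_eq_square)
    finally show ?thesis .
  qed
  have "card (clustered h y) \<le> card (\<Union>u\<in>{1..h}. \<Union>r\<in>?R u. \<Union>b\<in>tight_cells h y u r. cell h y b)"
    by (intro card_mono clustered_subset assms finite_UN_I) (auto simp: cell_def)
  also have "\<dots> \<le> (\<Sum>u\<in>{1..h}. card (\<Union>r\<in>?R u. \<Union>b\<in>tight_cells h y u r. cell h y b))"
    by (rule card_UN_le) simp
  also have "\<dots> \<le> (\<Sum>u\<in>{1..h}. \<Sum>r\<in>?R u. card (\<Union>b\<in>tight_cells h y u r. cell h y b))"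
    by (intro sum_mono card_UN_le) simp
  finally have "real (card (clustered h y))
      \<le> (\<Sum>u\<in>{1..h}. \<Sum>r\<in>?R u. real (card (\<Union>b\<in>tight_cells h y u r. cell h y b)))"
    by (simp flip: of_nat_sum)
  also have "\<dots> \<le> (\<Sum>u\<in>{1..h}. \<Sum>r\<in>?R u. 160 * (\<delta> / curv) / (real u)\<^sup>2)"
    using inner by (intro sum_mono) auto
  also have "\<dots> = (\<Sum>u\<in>{1..h}. real (card (?R u)) * (160 * (\<delta> / curv) / (real u)\<^sup>2))"
    by simp
  also have "\<dots> \<le> (\<Sum>u\<in>{1..h}. (3 * M * slope * real u) * (160 * (\<delta> / curv) / (real u)\<^sup>2))"
    using M slope_pos delta curv_pos by (intro sum_mono mult_right_mono) auto
  also have "\<dots> = (\<Sum>u\<in>{1..h}. 480 * M * slope * (\<delta> / curv) * inverse (real u))"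
    by (intro sum.cong refl) (auto simp: power2_eq_square field_simps)
  also have "\<dots> = 480 * M * slope * (\<delta> / curv) * harm h"
    by (simp add: harm_def sum_distrib_left)
  finally show ?thesis .
qed

section \<open>Isolated points and the triples they start\<close>

definition good :: "nat \<Rightarrow> nat \<Rightarrow> nat \<Rightarrow> nat set" where
  "good h U y = {x \<in> pts y. \<exists>u v. 1 \<le> u \<and> 1 \<le> v \<and> h \<le> u \<and> h \<le> v \<and> u + v \<le> U \<and> x + u \<in> pts y \<and> x + u + v \<in> pts y}"

text \<open>Isolated points occupy different cells, so of four successors in the same block of
  length \<open>U\<close> the second and the fourth give two gaps that each skip a whole cell and
  hence are at least \<open>h\<close>. Thus at most 4 points per block fail, and there are at most 3
  X / U blocks.\<close>

lemma card_isolated_not_good: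
  assumes "1 \<le> h" "1 \<le> U" "real U \<le> X"
  shows "real (card (pts y - clustered h y - good h U y)) \<le> 12 * X / real U"
proof -
  define S where "S = pts y - clustered h y"
  define A where "A = (\<lambda>b. {x \<in> S. x div U = b})"
  define Bs where "Bs = (\<lambda>x. x div U) ` S"
  have fin: "finite S" "finite Bs" "\<And>b. finite (A b)" by (auto simp: S_def A_def Bs_def)
  have div_lt: "x div h < z div h" if "x \<in> S" "z \<in> S" "x < z" for x z
  proof -
    have "x div h \<noteq> z div h" using that by (auto simp: S_def clustered_def)
    moreover have "x div h \<le> z div h" using that by (intro div_le_mono) auto
    ultimately show ?thesis by simp
  qed
  have far: "h \<le> z - x \<and> x < z" if "x div h + 2 \<le> z div h" for x z
  proof -
    have "0 < h" using assms by simp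
    have "(x div h + 2) * h \<le> z div h * h" using that by (intro mult_right_mono) auto
    hence "x div h * h + h + h \<le> z div h * h" by (simp add: algebra_simps)
    thus ?thesis
      using dividend_less_div_times[OF \<open>0 < h\<close>, of x] div_times_less_eq_dividend[of z h] by linarith
  qed
  have sub: "S - good h U y \<subseteq> (\<Union>b\<in>Bs. {x \<in> A b. card {z \<in> A b. x < z} \<le> 3})"
  proof
    fix x assume x: "x \<in> S - good h U y"
    define b where "b = x div U"
    have "card {z \<in> A b. x < z} \<le> 3"
    proof (rule ccontr)
      assume "\<not> ?thesis"
      hence "finite {z \<in> A b. x < z}" "4 \<le> card {z \<in> A b. x < z}" using fin(3) by simp_all
      then obtain p q r s where c: "p \<in> {z \<in> A b. x < z}" "q \<in> {z \<in> A b. x < z}" "r \<in> {z \<in> A b. x < z}"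
          "s \<in> {z \<in> A b. x < z}" "p < q" "q < r" "r < s"
        by (rule ex_chain_four)
      have S: "x \<in> S" "p \<in> S" "q \<in> S" "r \<in> S" "s \<in> S" "x < p" "s div U = b" using c x by (auto simp: A_def)
      have "x div h + 2 \<le> q div h" "q div h + 2 \<le> s div h"
        using div_lt[OF S(1,2,6)] div_lt[OF S(2,3) c(5)] div_lt[OF S(3,4) c(6)] div_lt[OF S(4,5) c(7)] by linarith+
      note f = far[OF this(1)] far[OF this(2)]
      have "0 < U" using assms by simp
      moreover have "s div U * U = x div U * U" using S(7) by (simp add: b_def)
      ultimately have "s \<le> x + U"
        using dividend_less_div_times[OF \<open>0 < U\<close>, of s] div_times_less_eq_dividend[of x U] by linarith
      hence "\<exists>u v. 1 \<le> u \<and> 1 \<le> v \<and> h \<le> u \<and> h \<le> v \<and> u + v \<le> U \<and> x + u \<in> pts y \<and> x + u + v \<in> pts y"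
        using f assms S by - (rule exI[of _ "q - x"], rule exI[of _ "s - q"], auto simp: S_def)
      hence "x \<in> good h U y" using S(1) by (auto simp: S_def good_def)
      thus False using x by simp
    qed
    moreover have "x \<in> A b" "b \<in> Bs" using x by (auto simp: A_def Bs_def b_def)
    ultimately show "x \<in> (\<Union>b\<in>Bs. {x \<in> A b. card {z \<in> A b. x < z} \<le> 3})" by blast
  qed
  have "card (S - good h U y) \<le> card (\<Union>b\<in>Bs. {x \<in> A b. card {z \<in> A b. x < z} \<le> 3})"
    using sub fin by (intro card_mono finite_UN_I) auto
  also have "\<dots> \<le> (\<Sum>b\<in>Bs. card {x \<in> A b. card {z \<in> A b. x < z} \<le> 3})"
    using fin by (intro card_UN_le) auto
  also have "\<dots> \<le> (\<Sum>b\<in>Bs. 4)"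
    using card_few_above[OF fin(3), of _ 3] by (intro sum_mono) simp
  finally have "real (card (S - good h U y)) \<le> 4 * real (card Bs)" by simp
  also have "real (card Bs) \<le> (X / real U + 1) / 1 + 1"
  proof (rule card_le_spacing)
    fix b1 b2 assume "b1 \<in> Bs" "b2 \<in> Bs" "b1 < b2"
    then obtain x1 x2 where x: "x1 \<in> pts y" "x2 \<in> pts y" "b1 = x1 div U" "b2 = x2 div U"
      by (auto simp: Bs_def S_def)
    have "0 < U" using assms by simp
    have "x1 < x1 div U * U + U" "x2 div U * U \<le> x2"
      using dividend_less_div_times[OF \<open>0 < U\<close>, of x1] div_times_less_eq_dividend[of x2 U] by linarith+
    hence "real x1 \<le> real (b1 * U + U)" "real (b2 * U) \<le> real x2"
      unfolding x(3,4) of_nat_le_iff by auto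
    hence "(real b2 - real b1) * real U \<le> X + real U"
      using ptsD(1)[OF x(1)] ptsD(2)[OF x(2)] by (simp add: algebra_simps)
    hence "real b2 - real b1 \<le> (X + real U) / real U"
      using \<open>0 < U\<close> by (simp only: pos_le_divide_eq of_nat_0_less_iff)
    thus "real b2 - real b1 \<le> X / real U + 1"
      using \<open>0 < U\<close> by (simp only: add_divide_distrib) simp
  qed (use fin X in auto)
  also have "4 * ((X / real U + 1) / 1 + 1) \<le> 12 * X / real U"
    using assms by (simp add: field_simps)
  finally show ?thesis by (simp add: S_def)
qed

text \<open>The quantity \<open>t\<close> is twice the area of the triangle spanned by three points on a curve.\<close>

definition triples :: "nat \<Rightarrow> nat \<Rightarrow> nat \<Rightarrow> nat \<Rightarrow> nat \<Rightarrow> nat \<Rightarrow> (nat \<times> nat) set" where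
  "triples h U u r t v = {(y, x). y \<in> Ys \<and> x \<in> pts y \<and> x + u \<in> pts y \<and> x + u + v \<in> pts y
     \<and> 1 \<le> u \<and> 1 \<le> v \<and> h \<le> u \<and> h \<le> v \<and> u + v \<le> U
     \<and> rise y x u = int r \<and> int u * rise y (x + u) v - int v * rise y x u = int t}"

section \<open>Areas of triples and the curves they can lie on\<close>

lemma det_approx:
  assumes "x \<in> pts y" "x + u \<in> pts y" "x + u + v \<in> pts y"
  shows "\<bar>w y * snd_diff \<beta> (real u) (real v) (real x) - of_int (int u * rise y (x + u) v - int v * rise y x u)\<bar>
    \<le> 2 * \<delta> * (real u + real v)"
proof -
  have "\<bar>real u * (w y * fst_diff \<beta> (real v) (real (x + u)) - rise y (x + u) v)\<bar> \<le> real u * (2 * \<delta>)"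
    using rise_approx[of "x + u" y v] assms unfolding abs_mult by (intro mult_mono) auto
  moreover have "\<bar>real v * (w y * fst_diff \<beta> (real u) (real x) - rise y x u)\<bar> \<le> real v * (2 * \<delta>)"
    using rise_approx[of x y u] assms unfolding abs_mult by (intro mult_mono) auto
  moreover have "w y * snd_diff \<beta> (real u) (real v) (real x) - of_int (int u * rise y (x + u) v - int v * rise y x u)
    = real u * (w y * fst_diff \<beta> (real v) (real (x + u)) - rise y (x + u) v)
      - real v * (w y * fst_diff \<beta> (real u) (real x) - rise y x u)"
    by (simp add: snd_diff_def algebra_simps)
  ultimately show ?thesis by (simp add: algebra_simps)
qed

text \<open>With q = curv * u * v * (u + v), the exact cross product is at least q / 4 and the
  rounding error at most 2 q / 9, which is smaller; so the integer \<open>t\<close> is positive. The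
  last bound serves to trade a relative error in terms of the rise for one in terms of
  \<open>t\<close>.\<close>

lemma det_bounds:
  assumes "y \<in> Ys" "x \<in> pts y" "x + u \<in> pts y" "x + u + v \<in> pts y" "1 \<le> u" "1 \<le> v" "h \<le> u" "h \<le> v" "u + v \<le> U"
    and h: "9 * \<delta> \<le> curv * real h ^ 2"
  defines "t \<equiv> int u * rise y (x + u) v - int v * rise y x u"
  shows "1 \<le> t" "real_of_int t \<le> M * curv * real U ^ 3" "real_of_int t \<le> 6 * M * real U * rise y x u"
proof -
  have hh: "9 * \<delta> \<le> curv * (real u * real v)"
  proof -
    have "real h ^ 2 \<le> real u * real v"
      using assms unfolding power2_eq_square by (intro mult_mono) auto
    hence "curv * real h ^ 2 \<le> curv * (real u * real v)" using curv_pos by simp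
    thus ?thesis using h by linarith
  qed
  have s: "9 * \<delta> * (real u + real v) \<le> curv * (real u * real v * (real u + real v))"
    using mult_right_mono[OF hh, of "real u + real v"] by (simp add: mult_ac)
  have xx: "X \<le> real x" "real (x + u + v) \<le> 2 * X" using ptsD(1)[OF assms(2)] ptsD(2)[OF assms(4)] by auto
  define q where "q = curv * (real u * real v * (real u + real v))"
  define d where "d = \<delta> * (real u + real v)"
  define E where "E = w y * snd_diff \<beta> (real u) (real v) (real x)"
  have b: "q / 4 \<le> E" "E \<le> M * q / 2"
    using second_bounds[OF assms(1) xx assms(5,6)] by (simp_all add: q_def E_def mult.assoc)
  have a: "\<bar>E - of_int t\<bar> \<le> 2 * d"
    using det_approx[OF assms(2-4), folded t_def] by (simp add: E_def d_def mult.assoc)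
  have s: "9 * d \<le> q" using s by (simp add: q_def d_def mult.assoc)
  have p: "0 < d" using delta assms by (simp add: d_def)
  have "0 < real_of_int t" using a b(1) s p by linarith
  thus "1 \<le> t" by linarith
  have "q \<le> M * q" using M s p by simp
  hence "real_of_int t \<le> M * q" using a b(2) s p by linarith
  hence "real_of_int t \<le> M * (curv * (real u * real v * (real u + real v)))" by (simp add: q_def)
  also have "\<dots> \<le> M * (curv * (real U * real U * real U))"
    using M curv_pos assms by (intro mult_left_mono mult_mono) auto
  finally show "real_of_int t \<le> M * curv * real U ^ 3" by (simp add: power3_eq_cube mult_ac)
  have r: "slope * real u / 2 \<le> rise y x u" "1 \<le> rise y x u" "rise y (x + u) v \<le> 3 * M * slope * real v"
    using rise_bounds[of y x u] rise_bounds[of y "x + u" v] assms by auto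
  have "real_of_int t \<le> real u * rise y (x + u) v"
    using r(2) by (simp add: t_def)
  also have "\<dots> \<le> real u * (3 * M * slope * real v)"
    using r(3) by (intro mult_left_mono) auto
  also have "\<dots> = 3 * M * real v * (slope * real u)" by simp
  also have "\<dots> \<le> 3 * M * real U * (2 * rise y x u)"
    using r assms M slope_pos by (intro mult_mono) auto
  finally show "real_of_int t \<le> 6 * M * real U * rise y x u" by simp
qed

text \<open>Both differences are prescribed, one is increasing and the other decreasing in \<open>x\<close>: whichever of
  \<open>x1\<close>, \<open>x2\<close> is larger, comparing the first differences bounds \<open>w y1 / w y2\<close> from one side and comparing
  the second differences bounds it from the other.\<close>

lemma triples_w_close:
  assumes A: "(y1, x1) \<in> triples h U u r t v" "(y2, x2) \<in> triples h U u r t v"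
    and t: "1 \<le> t" and h: "9 * \<delta> \<le> curv * real h ^ 2" and U: "4 * \<delta> * real U \<le> 1"
  shows "\<bar>ln (w y1) - ln (w y2)\<bar> \<le> 48 * M * \<delta> * real U / real t"
proof -
  have main: "\<bar>ln (w y1) - ln (w y2)\<bar> \<le> 48 * M * \<delta> * real U / real t"
    if A: "(y1, x1) \<in> triples h U u r t v" "(y2, x2) \<in> triples h U u r t v" and le: "x1 \<le> x2" for y1 y2 x1 x2
  proof -
    note T = A[unfolded triples_def, simplified]
    have y: "y1 \<in> Ys" "y2 \<in> Ys" using T by auto
    note w = w_pos[OF y(1)] w_pos[OF y(2)]
    have x1: "x1 \<in> pts y1" "x1 + u \<in> pts y1" "x1 + u + v \<in> pts y1"
      and x2: "x2 \<in> pts y2" "x2 + u \<in> pts y2" "x2 + u + v \<in> pts y2"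
      and uv: "1 \<le> u" "1 \<le> v" "h \<le> u" "h \<le> v" "u + v \<le> U" using T by auto
    \<comment> \<open>\<open>e\<close> dominates the error 2 \<delta> (u + v) of the cross product,
      and the hypothesis on \<open>U\<close> makes it at most 1/2, hence at most t / 2.\<close>
    define e where "e = 2 * \<delta> * real U"
    have e: "0 \<le> e" "e \<le> real t / 2" using U t delta by (auto simp: e_def)
    have r1: "1 \<le> r" using rise_bounds(3)[OF y(1) x1(1,2) uv(1)] T by simp
    have U1: "1 \<le> real U" using uv by simp
    have "\<delta> * 1 \<le> \<delta> * real U" using U1 delta by (intro mult_left_mono) auto
    moreover have "1 \<le> real r" using r1 by simp
    ultimately have d: "0 \<le> 2 * \<delta>" "2 * \<delta> \<le> real r / 2" using U delta by linarith+
    let ?D = "fst_diff \<beta> (real u)" and ?E = "snd_diff \<beta> (real u) (real v)"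
    have D: "\<bar>w y1 * ?D (real x1) - real r\<bar> \<le> 2 * \<delta>" "\<bar>w y2 * ?D (real x2) - real r\<bar> \<le> 2 * \<delta>"
      using rise_approx[OF x1(1,2)] rise_approx[OF x2(1,2)] T by auto
    have tt: "int u * rise y1 (x1 + u) v - int v * rise y1 x1 u = int t"
        "int u * rise y2 (x2 + u) v - int v * rise y2 x2 u = int t"
      using A by (auto simp: triples_def)
    have "2 * \<delta> * (real u + real v) \<le> e"
      unfolding e_def using uv delta by (intro mult_left_mono) auto
    moreover have "\<bar>w y1 * ?E (real x1) - real t\<bar> \<le> 2 * \<delta> * (real u + real v)"
        "\<bar>w y2 * ?E (real x2) - real t\<bar> \<le> 2 * \<delta> * (real u + real v)"
      using det_approx[OF x1] det_approx[OF x2] unfolding tt of_int_of_nat_eq .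
    ultimately have E: "\<bar>w y1 * ?E (real x1) - real t\<bar> \<le> e" "\<bar>w y2 * ?E (real x2) - real t\<bar> \<le> e" by linarith+
    have Xx: "X \<le> real x1" "real (x2 + u) \<le> 2 * X" using ptsD[OF x1(1)] ptsD[OF x2(2)] by auto
    have "0 < real u" "0 < real v" using uv by auto
    hence mono: "?D (real x1) \<le> ?D (real x2)" "?E (real x2) \<le> ?E (real x1)"
    proof -
      have "0 \<le> \<beta> * (\<beta> - 1) * X powr (\<beta> - 2) / 2 * real u * (real x2 - real x1)" using beta le by simp
      thus "?D (real x1) \<le> ?D (real x2)"
        using fst_diff_increase[OF beta X, of "real x1" "real x2" "real u"] Xx le \<open>0 < real u\<close> by simp
      show "?E (real x2) \<le> ?E (real x1)"
        using snd_diff_antimono[OF beta, of "real x1" "real x2" "real u" "real v"] Xx X le \<open>0 < real u\<close> \<open>0 < real v\<close>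
        by simp
    qed
    have "w y2 * (real r - 2 * \<delta>) \<le> w y2 * (w y1 * ?D (real x1))"
      using D w by (intro mult_left_mono) auto
    also have "\<dots> \<le> w y2 * (w y1 * ?D (real x2))"
      using mono w by (intro mult_left_mono) auto
    also have "\<dots> = w y1 * (w y2 * ?D (real x2))" by simp
    also have "\<dots> \<le> w y1 * (real r + 2 * \<delta>)"
      using D w by (intro mult_left_mono) auto
    finally have 1: "w y2 / w y1 \<le> (real r + 2 * \<delta>) / (real r - 2 * \<delta>)"
      using w d r1 by (simp add: divide_simps mult_ac)
    have "w y1 * (real t - e) \<le> w y1 * (w y2 * ?E (real x2))"
      using E w by (intro mult_left_mono) auto
    also have "\<dots> \<le> w y1 * (w y2 * ?E (real x1))"
      using mono w by (intro mult_left_mono) auto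
    also have "\<dots> = w y2 * (w y1 * ?E (real x1))" by simp
    also have "\<dots> \<le> w y2 * (real t + e)"
      using E w by (intro mult_left_mono) auto
    finally have 2: "w y1 / w y2 \<le> (real t + e) / (real t - e)"
      using w e t by (simp add: divide_simps mult_ac)
    have "ln (w y2) - ln (w y1) = ln (w y2 / w y1)" using w by (simp add: ln_div)
    also have "\<dots> \<le> ln ((real r + 2 * \<delta>) / (real r - 2 * \<delta>))" using 1 w by (intro ln_mono) auto
    also have "\<dots> \<le> 4 * (2 * \<delta>) / real r" using r1 d by (intro ln_ratio_le) auto
    also have "\<dots> = 8 * \<delta> * (1 / real r)" by simp
    \<comment> \<open>The first difference is known with relative error of order \<delta> / r;
      \<open>det_bounds\<close> turns this into \<delta> U / t, the precision of the second
      difference.\<close>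
    also have "\<dots> \<le> 8 * \<delta> * (6 * M * real U / real t)"
    proof (intro mult_left_mono)
      have "real t \<le> 6 * M * real U * real r"
        using det_bounds(3)[OF y(1) x1 uv h, unfolded tt(1)] T by simp
      thus "1 / real r \<le> 6 * M * real U / real t" using t r1 by (simp add: divide_simps)
    qed (use delta in auto)
    finally have a: "ln (w y2) - ln (w y1) \<le> 48 * M * \<delta> * real U / real t" by (simp add: mult_ac)
    have "ln (w y1) - ln (w y2) = ln (w y1 / w y2)" using w by (simp add: ln_div)
    also have "\<dots> \<le> ln ((real t + e) / (real t - e))" using 2 w by (intro ln_mono) auto
    also have "\<dots> \<le> 4 * e / real t" using t e by (intro ln_ratio_le) auto
    also have "\<dots> = 8 * (\<delta> * real U) / real t" by (simp add: e_def)
    also have "\<dots> \<le> 48 * M * (\<delta> * real U) / real t"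
      using M delta by (intro divide_right_mono mult_right_mono) auto
    finally have b: "ln (w y1) - ln (w y2) \<le> 48 * M * \<delta> * real U / real t" by (simp add: mult_ac)
    show ?thesis using a b by linarith
  qed
  show ?thesis
  proof (cases "x1 \<le> x2")
    case False
    thus ?thesis using main[OF A(2,1)] by (simp add: abs_minus_commute)
  qed (use main[OF A] in simp)
qed

lemma finite_triples: "finite (triples h U u r t v)"
  by (rule finite_subset[of _ "Sigma Ys pts"]) (auto simp: triples_def fin_Ys)

text \<open>Since \<open>u\<close>, \<open>r\<close>, \<open>t\<close>, \<open>v\<close> fix both
  edge vectors, \<open>triples_w_close\<close> and \<open>w_sep\<close> confine the parameter
  \<open>y\<close> to a short interval; on each curve \<open>rise_window\<close> confines
  \<open>x\<close>.\<close>

lemma card_triples: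
  assumes t: "1 \<le> t" and u: "1 \<le> u" and h: "9 * \<delta> \<le> curv * real h ^ 2" and U: "4 * \<delta> * real U \<le> 1"
  shows "real (card (triples h U u r t v))
    \<le> (1 + 48 * M * B * \<delta> * real U / real t) * (1 + 8 * \<delta> / curv / real u)"
proof -
  let ?F = "triples h U u r t v"
  let ?S = "\<lambda>y. {x. (y, x) \<in> ?F}"
  have finS: "finite (?S y)" for y
    by (rule finite_subset[of _ "pts y"]) (auto simp: triples_def)
  have F: "?F = Sigma (fst ` ?F) ?S" by force
  have ys: "real (card (fst ` ?F)) \<le> 48 * M * B * \<delta> * real U / real t / 1 + 1"
  proof (rule card_le_spacing)
    fix y1 y2 assume y: "y1 \<in> fst ` ?F" "y2 \<in> fst ` ?F" "y1 < y2"
    then obtain x1 x2 where x: "(y1, x1) \<in> ?F" "(y2, x2) \<in> ?F" by force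
    hence "y1 \<in> Ys" "y2 \<in> Ys" by (auto simp: triples_def)
    hence "\<bar>real y2 - real y1\<bar> \<le> B * \<bar>ln (w y2) - ln (w y1)\<bar>" by (intro w_sep)
    also have "\<dots> \<le> B * (48 * M * \<delta> * real U / real t)"
      using triples_w_close[OF x(2,1) t h U] B by (intro mult_left_mono)
    finally show "real y2 - real y1 \<le> 48 * M * B * \<delta> * real U / real t" by (simp add: mult_ac)
  qed (use finite_triples M B delta in auto)
  have xs: "real (card (?S y)) \<le> 8 * \<delta> / curv / real u / 1 + 1" for y
  proof (rule card_le_spacing)
    fix x1 x2 assume "x1 \<in> ?S y" "x2 \<in> ?S y" "x1 < x2"
    thus "real x2 - real x1 \<le> 8 * \<delta> / curv / real u"
      by (intro rise_window[of y]) (auto simp: triples_def)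
  qed (use finS delta curv_pos in auto)
  have "real (card ?F) = (\<Sum>y\<in>fst ` ?F. real (card (?S y)))"
    by (subst F, subst card_SigmaI) (use finS finite_triples in auto)
  also have "\<dots> \<le> (\<Sum>y\<in>fst ` ?F. 8 * \<delta> / curv / real u / 1 + 1)"
    by (intro sum_mono xs)
  also have "\<dots> = real (card (fst ` ?F)) * (8 * \<delta> / curv / real u / 1 + 1)" by simp
  also have "\<dots> \<le> (48 * M * B * \<delta> * real U / real t / 1 + 1) * (8 * \<delta> / curv / real u / 1 + 1)"
    using ys delta curv_pos by (intro mult_right_mono) auto
  finally show ?thesis by (simp add: add.commute)
qed

text \<open>The rise of the second edge need not be summed over: it equals (r v + t) / u, and its
  integrality is the divisibility condition on \<open>v\<close>.\<close>

lemma good_subset: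
  assumes h: "9 * \<delta> \<le> curv * real h ^ 2"
  shows "Sigma Ys (good h U) \<subseteq> (\<Union>u\<in>{1..U}. \<Union>r\<in>{1..nat \<lfloor>3 * M * slope * real u\<rfloor>}.
    \<Union>t\<in>{1..nat \<lfloor>M * curv * real U ^ 3\<rfloor>}. \<Union>v\<in>{v \<in> {1..U}. u dvd r * v + t}. triples h U u r t v)"
proof
  fix p assume "p \<in> Sigma Ys (good h U)"
  then obtain y x where p: "p = (y, x)" "y \<in> Ys" "x \<in> good h U y" by blast
  then obtain u v where uv: "x \<in> pts y" "x + u \<in> pts y" "x + u + v \<in> pts y" "1 \<le> u" "1 \<le> v" "h \<le> u" "h \<le> v" "u + v \<le> U"
    unfolding good_def by blast
  define r where "r = nat (rise y x u)"
  define t where "t = nat (int u * rise y (x + u) v - int v * rise y x u)"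
  note rb = rise_bounds[OF p(2) uv(1,2,4)]
  note tb = det_bounds[OF p(2) uv h]
  have r: "int r = rise y x u" "1 \<le> r" using rb(3) by (auto simp: r_def)
  have t: "int t = int u * rise y (x + u) v - int v * rise y x u" "1 \<le> t" using tb(1) by (auto simp: t_def)
  have "real r = of_int (int r)" by simp
  hence "real r \<le> 3 * M * slope * real u" using rb(2) unfolding r(1) by linarith
  hence rR: "r \<in> {1..nat \<lfloor>3 * M * slope * real u\<rfloor>}" using r(2) by (simp add: le_nat_floor)
  have "real t = of_int (int t)" by simp
  hence "real t \<le> M * curv * real U ^ 3" using tb(2) unfolding t(1) by linarith
  hence tT: "t \<in> {1..nat \<lfloor>M * curv * real U ^ 3\<rfloor>}" using t(2) by (simp add: le_nat_floor)
  have "int (r * v + t) = int u * rise y (x + u) v" using r(1) t(1) by simp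
  hence "int u dvd int (r * v + t)" by simp
  hence "u dvd r * v + t" by (simp only: int_dvd_int_iff)
  hence vV: "v \<in> {v \<in> {1..U}. u dvd r * v + t}" using uv by auto
  have "p \<in> triples h U u r t v" using p uv r t by (auto simp: triples_def)
  moreover have "u \<in> {1..U}" using uv by auto
  ultimately show "p \<in> (\<Union>u\<in>{1..U}. \<Union>r\<in>{1..nat \<lfloor>3 * M * slope * real u\<rfloor>}.
    \<Union>t\<in>{1..nat \<lfloor>M * curv * real U ^ 3\<rfloor>}. \<Union>v\<in>{v \<in> {1..U}. u dvd r * v + t}. triples h U u r t v)"
    using rR tT vV by blast
qed

text \<open>Summing over \<open>v\<close> and \<open>t\<close> by \<open>sum_residue_class\<close>
  leaves a factor U / u, which is cancelled by the O(slope * u) values of \<open>r\<close>. The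
  window factor 1 + \<kappa> / u then sums to U + \<kappa> * harm U.\<close>

lemma card_good:
  assumes h: "9 * \<delta> \<le> curv * real h ^ 2" and U: "4 * \<delta> * real U \<le> 1"
  shows "real (card (Sigma Ys (good h U))) \<le> 6 * M * slope * real U
    * (M * curv * real U ^ 3 + 48 * M * B * \<delta> * real U * harm (nat \<lfloor>M * curv * real U ^ 3\<rfloor>))
    * (real U + 8 * \<delta> / curv * harm U)"
proof -
  define R where "R = (\<lambda>u::nat. nat \<lfloor>3 * M * slope * real u\<rfloor>)"
  define T where "T = nat \<lfloor>M * curv * real U ^ 3\<rfloor>"
  define V where "V = (\<lambda>u r t. {v \<in> {1..U}. u dvd r * v + t})"
  define K where "K = 48 * M * B * \<delta> * real U"
  define \<kappa> where "\<kappa> = 8 * \<delta> / curv"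
  have K: "0 \<le> K" using M B delta by (simp add: K_def)
  have k: "0 \<le> \<kappa>" using delta curv_pos by (simp add: \<kappa>_def)
  have T: "real T \<le> M * curv * real U ^ 3" unfolding T_def using M curv_pos by simp
  have finV: "finite (V u r t)" for u r t by (simp add: V_def)
  let ?H = "real T + K * harm T"
  have H: "0 \<le> ?H" using K harm_nonneg[of T, where 'a = real] by simp
  have "card (Sigma Ys (good h U)) \<le> card (\<Union>u\<in>{1..U}. \<Union>r\<in>{1..R u}. \<Union>t\<in>{1..T}. \<Union>v\<in>V u r t. triples h U u r t v)"
    unfolding R_def T_def V_def using good_subset[OF h] finite_triples
    by (intro card_mono finite_UN_I) auto
  also have "\<dots> \<le> (\<Sum>u\<in>{1..U}. card (\<Union>r\<in>{1..R u}. \<Union>t\<in>{1..T}. \<Union>v\<in>V u r t. triples h U u r t v))"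
    by (rule card_UN_le) simp
  also have "\<dots> \<le> (\<Sum>u\<in>{1..U}. \<Sum>r\<in>{1..R u}. card (\<Union>t\<in>{1..T}. \<Union>v\<in>V u r t. triples h U u r t v))"
    by (intro sum_mono card_UN_le) simp
  also have "\<dots> \<le> (\<Sum>u\<in>{1..U}. \<Sum>r\<in>{1..R u}. \<Sum>t\<in>{1..T}. card (\<Union>v\<in>V u r t. triples h U u r t v))"
    by (intro sum_mono card_UN_le) simp
  also have "\<dots> \<le> (\<Sum>u\<in>{1..U}. \<Sum>r\<in>{1..R u}. \<Sum>t\<in>{1..T}. \<Sum>v\<in>V u r t. card (triples h U u r t v))"
    by (intro sum_mono card_UN_le finV)
  finally have "real (card (Sigma Ys (good h U)))
      \<le> (\<Sum>u\<in>{1..U}. \<Sum>r\<in>{1..R u}. \<Sum>t\<in>{1..T}. \<Sum>v\<in>V u r t. real (card (triples h U u r t v)))"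
    by (simp flip: of_nat_sum)
  also have "\<dots> \<le> (\<Sum>u\<in>{1..U}. \<Sum>r\<in>{1..R u}. \<Sum>t\<in>{1..T}. \<Sum>v\<in>V u r t. (1 + K / real t) * (1 + \<kappa> / real u))"
    unfolding K_def \<kappa>_def by (intro sum_mono card_triples h U) auto
  also have "\<dots> = (\<Sum>u\<in>{1..U}. \<Sum>r\<in>{1..R u}. (1 + \<kappa> / real u) * (\<Sum>t\<in>{1..T}. real (card (V u r t)) * (1 + K / real t)))"
    by (simp add: sum_distrib_left mult_ac)
  also have "\<dots> \<le> (\<Sum>u\<in>{1..U}. \<Sum>r\<in>{1..R u}. (1 + \<kappa> / real u) * (2 * real U / real u * ?H))"
    unfolding V_def using k K by (intro sum_mono mult_left_mono sum_residue_class) auto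
  also have "\<dots> = (\<Sum>u\<in>{1..U}. real (R u) * ((1 + \<kappa> / real u) * (2 * real U / real u * ?H)))" by simp
  also have "\<dots> \<le> (\<Sum>u\<in>{1..U}. (3 * M * slope * real u) * ((1 + \<kappa> / real u) * (2 * real U / real u * ?H)))"
    using M slope_pos k H by (intro sum_mono mult_right_mono) (auto simp: R_def)
  also have "\<dots> = (\<Sum>u\<in>{1..U}. 6 * M * slope * real U * ?H * (1 + \<kappa> * inverse (real u)))"
    by (intro sum.cong refl) (auto simp: divide_inverse)
  also have "\<dots> = 6 * M * slope * real U * ?H * (real U + \<kappa> * harm U)"
    by (simp add: sum_distrib_left[symmetric] sum.distrib harm_def)
  also have "\<dots> \<le> 6 * M * slope * real U * (M * curv * real U ^ 3 + K * harm T) * (real U + \<kappa> * harm U)"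
    using T M slope_pos k harm_nonneg[of U, where 'a = real] by (intro mult_right_mono mult_left_mono) auto
  finally show ?thesis by (simp only: K_def T_def \<kappa>_def)
qed

text \<open>The three contributions are clustered points, isolated points starting no triple, and
  triples. \<open>Z\<close> is a common majorant of the arguments of the three harmonic sums, so
  that one logarithm serves for all.\<close>

theorem card_points:
  assumes U: "1 \<le> U" "real U \<le> X" "4 * \<delta> * real U \<le> 1"
    and Z: "3 * (\<delta> / curv) + 4 \<le> Z" "M * curv * real U ^ 3 \<le> Z" "real U \<le> Z"
  shows "real (\<Sum>y\<in>Ys. card (pts y)) \<le> real (card Ys) * (480 * M * slope * (\<delta> / curv) * (1 + ln Z) + 12 * X / real U)
    + 6 * M * slope * real U * (M * curv * real U ^ 3 + 48 * M * B * \<delta> * real U * (1 + ln Z))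
      * (real U + 8 * \<delta> / curv * (1 + ln Z))"
proof -
  define q where "q = \<delta> / curv"
  have q: "0 < q" using delta curv_pos by (simp add: q_def)
  \<comment> \<open>The least cell length allowed by \<open>det_bounds\<close>. When it exceeds 1,
    rounding up at most doubles 3 * sqrt q, hence 36 = 4 * 9 in the bound for clusters.\<close>
  define h where "h = max 1 (nat \<lceil>3 * sqrt q\<rceil>)"
  have h1: "1 \<le> h" by (simp add: h_def)
  have "3 * sqrt q \<le> real h" unfolding h_def by linarith
  hence "(3 * sqrt q) ^ 2 \<le> real h ^ 2" using q by (intro power_mono) auto
  hence "9 * q \<le> real h ^ 2" using q by (simp add: power_mult_distrib)
  hence h9: "9 * \<delta> \<le> curv * real h ^ 2"
    using curv_pos by (simp add: q_def field_simps)
  have h36: "h = 1 \<or> real h ^ 2 \<le> 36 * \<delta> / curv"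
  proof (cases "h = 1")
    case False
    hence "real h \<le> 3 * sqrt q + 1" "2 \<le> h" unfolding h_def by linarith+
    hence "real h \<le> 6 * sqrt q" by linarith
    hence "real h ^ 2 \<le> (6 * sqrt q) ^ 2" by (intro power_mono) auto
    also have "\<dots> = 36 * \<delta> / curv" using q by (simp add: power_mult_distrib q_def)
    finally show ?thesis by simp
  qed simp
  have Z1: "1 \<le> Z" using Z(1) q by (simp add: q_def)
  have harm: "harm n \<le> 1 + ln Z" if "real n \<le> Z" for n
  proof (cases "n = 0")
    case True
    thus ?thesis using Z1 by (simp add: harm_def)
  next
    case False
    have "harm n \<le> 1 + ln (real n)" using False by (intro harm_le_ln) simp
    also have "ln (real n) \<le> ln Z" using False that Z1 by simp
    finally show ?thesis by simp
  qed
  have hZ: "real h \<le> Z"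
  proof -
    have "0 \<le> sqrt q" using q by simp
    hence "real h \<le> 3 * sqrt q + 1" unfolding h_def by linarith
    moreover have "sqrt q \<le> q + 1" using q by (intro real_le_lsqrt) (auto simp: power2_eq_square algebra_simps)
    ultimately show ?thesis using Z(1) by (simp add: q_def)
  qed
  have TZ: "real (nat \<lfloor>M * curv * real U ^ 3\<rfloor>) \<le> Z"
  proof -
    have "0 \<le> M * curv * real U ^ 3" using M curv_pos by simp
    thus ?thesis using Z(2) by linarith
  qed
  have "real (\<Sum>y\<in>Ys. card (pts y)) \<le> real (\<Sum>y\<in>Ys. card (clustered h y) + card (pts y - clustered h y - good h U y) + card (good h U y))"
  proof (intro of_nat_mono sum_mono)
    fix y
    have "card (pts y) \<le> card (clustered h y \<union> (pts y - clustered h y - good h U y) \<union> good h U y)"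
      by (intro card_mono) (auto simp: clustered_def good_def)
    also have "\<dots> \<le> card (clustered h y) + card (pts y - clustered h y - good h U y) + card (good h U y)"
      by (intro order.trans[OF card_Un_le] add_mono card_Un_le) simp
    finally show "card (pts y) \<le> card (clustered h y) + card (pts y - clustered h y - good h U y) + card (good h U y)" .
  qed
  also have "\<dots> = (\<Sum>y\<in>Ys. real (card (clustered h y)) + real (card (pts y - clustered h y - good h U y)))
      + real (card (Sigma Ys (good h U)))"
  proof -
    have "finite (good h U y)" for y by (simp add: good_def)
    thus ?thesis using fin_Ys by (simp add: card_SigmaI sum.distrib)
  qed
  also have "\<dots> \<le> (\<Sum>y\<in>Ys. 480 * M * slope * (\<delta> / curv) * (1 + ln Z) + 12 * X / real U)
      + 6 * M * slope * real U * (M * curv * real U ^ 3 + 48 * M * B * \<delta> * real U * (1 + ln Z))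
      * (real U + 8 * \<delta> / curv * (1 + ln Z))"
  proof (intro add_mono sum_mono)
    fix y assume y: "y \<in> Ys"
    have "real (card (clustered h y)) \<le> 480 * M * slope * (\<delta> / curv) * harm h"
      by (rule card_clustered[OF y h1 h36])
    also have "\<dots> \<le> 480 * M * slope * (\<delta> / curv) * (1 + ln Z)"
      using M slope_pos delta curv_pos by (intro mult_left_mono harm hZ) auto
    finally show "real (card (clustered h y)) \<le> 480 * M * slope * (\<delta> / curv) * (1 + ln Z)" .
    show "real (card (pts y - clustered h y - good h U y)) \<le> 12 * X / real U"
      by (rule card_isolated_not_good[OF h1 U(1,2)])
  next
    note card_good[OF h9 U(3)]
    also have "6 * M * slope * real U
      * (M * curv * real U ^ 3 + 48 * M * B * \<delta> * real U * harm (nat \<lfloor>M * curv * real U ^ 3\<rfloor>))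
      * (real U + 8 * \<delta> / curv * harm U) \<le>
      6 * M * slope * real U * (M * curv * real U ^ 3 + 48 * M * B * \<delta> * real U * (1 + ln Z))
      * (real U + 8 * \<delta> / curv * (1 + ln Z))"
    proof -
      let ?L = "1 + ln Z"
      have L: "harm (nat \<lfloor>M * curv * real U ^ 3\<rfloor>) \<le> ?L" "harm U \<le> ?L" "0 \<le> ?L" "0 \<le> (harm U :: real)"
        using harm[OF TZ] harm[OF Z(3)] Z1 harm_nonneg[of U, where 'a = real] by auto
      have nn: "0 \<le> 6 * M * slope * real U" "0 \<le> M * curv * real U ^ 3" "0 \<le> 48 * M * B * \<delta> * real U" "0 \<le> 8 * \<delta> / curv"
        using M slope_pos delta curv_pos B by simp_all
      show ?thesis
        by (intro mult_mono mult_left_mono add_left_mono order.refl L nn mult_nonneg_nonneg add_nonneg_nonneg of_nat_0_le_iff)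
    qed
    finally show "real (card (Sigma Ys (good h U))) \<le> 6 * M * slope * real U * (M * curv * real U ^ 3 + 48 * M * B * \<delta> * real U * (1 + ln Z))
      * (real U + 8 * \<delta> / curv * (1 + ln Z))" .
  qed
  finally show ?thesis by simp
qed

end

section \<open>Large square divisors\<close>

definition sq_pairs :: "real \<Rightarrow> real \<Rightarrow> real \<Rightarrow> (nat \<times> nat) set" where
  "sq_pairs c X Y = {(d, n). X \<le> real n \<and> real n \<le> 2 * X \<and> Y \<le> real d \<and> real d < 2 * Y
     \<and> d\<^sup>2 dvd nat \<lfloor>real n powr c\<rfloor>}"

lemma card_nat_Icc_le:
  fixes a b :: real
  assumes "0 \<le> a" "a \<le> b"
  shows "finite {n::nat. a \<le> real n \<and> real n \<le> b}"
    and "real (card {n::nat. a \<le> real n \<and> real n \<le> b}) \<le> b - a + 1"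
proof -
  show fin: "finite {n::nat. a \<le> real n \<and> real n \<le> b}"
    by (rule finite_subset[of _ "{..nat \<lfloor>b\<rfloor>}"]) (auto simp: le_nat_floor)
  have "real (card {n::nat. a \<le> real n \<and> real n \<le> b}) \<le> (b - a) / 1 + 1"
    using fin assms by (intro card_le_spacing) auto
  thus "real (card {n::nat. a \<le> real n \<and> real n \<le> b}) \<le> b - a + 1" by simp
qed

lemma nat_floor_bounds:
  fixes z :: real
  assumes "1 \<le> z"
  shows "1 \<le> nat \<lfloor>z\<rfloor>" "real (nat \<lfloor>z\<rfloor>) \<le> z" "z / 2 \<le> real (nat \<lfloor>z\<rfloor>)"
proof -
  have "1 \<le> \<lfloor>z\<rfloor>" using assms by simp
  moreover from this have "real (nat \<lfloor>z\<rfloor>) = of_int \<lfloor>z\<rfloor>" by simp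
  moreover have "of_int \<lfloor>z\<rfloor> \<le> z" "z < of_int \<lfloor>z\<rfloor> + 1" by linarith+
  moreover have "1 \<le> real_of_int \<lfloor>z\<rfloor>" using assms by simp
  ultimately show "1 \<le> nat \<lfloor>z\<rfloor>" "real (nat \<lfloor>z\<rfloor>) \<le> z" "z / 2 \<le> real (nat \<lfloor>z\<rfloor>)"
    by linarith+
qed

text \<open>The derivative of ln is at least 1 / Y on (0, Y]. This is the source of
  \<open>w_sep\<close> in both applications.\<close>

lemma ln_diff_ge:
  fixes p q Y :: real
  assumes "0 < p" "0 < q" "p \<le> Y" "q \<le> Y"
  shows "\<bar>p - q\<bar> \<le> Y * \<bar>ln p - ln q\<bar>"
proof -
  have *: "\<bar>p - q\<bar> \<le> Y * \<bar>ln p - ln q\<bar>" if "0 < p" "0 < q" "p \<le> Y" "q \<le> Y" "q \<le> p" for p q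
  proof -
    have "ln (q / p) \<le> q / p - 1" using that by (intro ln_le_minus_one) auto
    hence "(p - q) / p \<le> ln p - ln q" using that by (simp add: ln_div diff_divide_distrib)
    moreover have "(p - q) / Y \<le> (p - q) / p" using that by (intro divide_left_mono) auto
    ultimately have "(p - q) / Y \<le> ln p - ln q" by linarith
    moreover have "0 \<le> (p - q) / Y" using that by simp
    ultimately show ?thesis using that by (simp add: divide_le_eq mult_ac)
  qed
  show ?thesis
  proof (cases "q \<le> p")
    case False
    thus ?thesis using *[of q p] assms by (simp add: abs_minus_commute)
  qed (use *[of p q] assms in simp)
qed

text \<open>The derivative of n^c exceeds 1 from 1 on, so values at distinct naturals are at least 1
  apart and survive the floor.\<close>

lemma floor_powr_strict_mono:
  fixes c :: real
  assumes "1 < c" "1 \<le> n1" "n1 < n2"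
  shows "nat \<lfloor>real n1 powr c\<rfloor> < nat \<lfloor>real n2 powr c\<rfloor>"
proof -
  have "0 < real n1" "real n1 < real n2" using assms by auto
  then obtain z where z: "real n1 < z" "z < real n2"
      "real n2 powr c - real n1 powr c = (real n2 - real n1) * (c * z powr (c - 1))"
    by (rule powr_mvt)
  have "1 \<le> z powr (c - 1)" using z assms by (intro ge_one_powr_ge_zero) auto
  hence "1 * (1 * 1) \<le> (real n2 - real n1) * (c * z powr (c - 1))"
    using assms by (intro mult_mono) auto
  hence "real n1 powr c + 1 \<le> real n2 powr c" using z(3) by linarith
  hence "\<lfloor>real n1 powr c\<rfloor> + 1 \<le> \<lfloor>real n2 powr c\<rfloor>" by linarith
  moreover have "0 \<le> \<lfloor>real n1 powr c\<rfloor>" by simp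
  ultimately show ?thesis by linarith
qed

definition cofactor :: "real \<Rightarrow> nat \<times> nat \<Rightarrow> nat \<times> nat" where
  "cofactor c = (\<lambda>(d, n). (d, nat \<lfloor>real n powr c\<rfloor> div d\<^sup>2))"

lemma sq_pairsE:
  assumes "p \<in> sq_pairs c X Y" "1 < c" "1 \<le> X" "0 < Y"
  obtains d n a where "p = (d, n)" "cofactor c p = (d, a)" "X \<le> real n" "real n \<le> 2 * X" "Y \<le> real d" "real d < 2 * Y"
    "1 \<le> a" "(real d)\<^sup>2 * real a \<le> real n powr c" "real n powr c < (real d)\<^sup>2 * real a + 1"
proof -
  obtain d n where p: "p = (d, n)" "X \<le> real n" "real n \<le> 2 * X" "Y \<le> real d" "real d < 2 * Y"
    "d\<^sup>2 dvd nat \<lfloor>real n powr c\<rfloor>" using assms unfolding sq_pairs_def by blast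
  define a where "a = nat \<lfloor>real n powr c\<rfloor> div d\<^sup>2"
  have a: "nat \<lfloor>real n powr c\<rfloor> = d\<^sup>2 * a" using p by (simp add: a_def)
  have "1 \<le> real n powr c" using p assms by (intro ge_one_powr_ge_zero) auto
  hence "1 \<le> nat \<lfloor>real n powr c\<rfloor>" by linarith
  hence "1 \<le> a" unfolding a by (cases a) auto
  moreover have "real_of_int \<lfloor>real n powr c\<rfloor> = real (nat \<lfloor>real n powr c\<rfloor>)" by simp
  hence "real_of_int \<lfloor>real n powr c\<rfloor> = (real d)\<^sup>2 * real a" unfolding a by simp
  hence "(real d)\<^sup>2 * real a \<le> real n powr c" "real n powr c < (real d)\<^sup>2 * real a + 1"
    by linarith+
  ultimately show ?thesis using p by (intro that[of d n a]) (auto simp: cofactor_def a_def)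
qed

text \<open>From d and a one recovers the floor of n^c, hence n. Pairs (d, n) may therefore be
  counted as pairs (d, a).\<close>

lemma inj_on_cofactor:
  assumes "1 < c" "1 \<le> X" "0 < Y"
  shows "inj_on (cofactor c) (sq_pairs c X Y)"
proof (rule inj_onI)
  fix p q assume pq: "p \<in> sq_pairs c X Y" "q \<in> sq_pairs c X Y" "cofactor c p = cofactor c q"
  obtain d n d' n' where p: "p = (d, n)" "q = (d', n')" by (metis surj_pair)
  have eq: "d = d'" "nat \<lfloor>real n powr c\<rfloor> div d\<^sup>2 = nat \<lfloor>real n' powr c\<rfloor> div d\<^sup>2"
    using pq(3) p by (auto simp: cofactor_def)
  have dvd: "d\<^sup>2 dvd nat \<lfloor>real n powr c\<rfloor>" "d\<^sup>2 dvd nat \<lfloor>real n' powr c\<rfloor>" "1 \<le> n" "1 \<le> n'"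
    using pq(1,2) p eq assms by (auto simp: sq_pairs_def)
  hence "nat \<lfloor>real n powr c\<rfloor> = nat \<lfloor>real n' powr c\<rfloor>"
    using eq(2) by (metis dvd_mult_div_cancel)
  hence "n = n'"
    using floor_powr_strict_mono[OF assms(1) dvd(3), of n'] floor_powr_strict_mono[OF assms(1) dvd(4), of n]
    by (metis less_irrefl linorder_neqE_nat)
  thus "p = q" using p eq by simp
qed

lemma finite_sq_pairs [simp]: "finite (sq_pairs c X Y)"
  by (rule finite_subset[of _ "{..nat \<lfloor>2 * Y\<rfloor>} \<times> {..nat \<lfloor>2 * X\<rfloor>}"]) (auto simp: sq_pairs_def le_nat_floor)

text \<open>At most 2 Y values of d, and a <= 4 X^c / Y^2 for each. This saves a power of X once Y
  exceeds X^(c-1) by one.\<close>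

lemma card_sq_pairs_trivial:
  assumes c: "1 < c" "c < 2" and X: "1 \<le> X" and Y: "1 \<le> Y"
  shows "real (card (sq_pairs c X Y)) \<le> 8 * X powr c / Y"
proof -
  define A where "A = 4 * X powr c / Y\<^sup>2"
  let ?D = "{d::nat. Y \<le> real d \<and> real d \<le> 2 * Y}"
  have D: "finite ?D" "real (card ?D) \<le> 2 * Y" using card_nat_Icc_le[of Y "2 * Y"] Y by auto
  have "cofactor c ` sq_pairs c X Y \<subseteq> ?D \<times> {1..nat \<lfloor>A\<rfloor>}"
  proof
    fix q assume "q \<in> cofactor c ` sq_pairs c X Y"
    then obtain p where p: "p \<in> sq_pairs c X Y" "q = cofactor c p" by blast
    obtain d n a where da: "cofactor c p = (d, a)" "real n \<le> 2 * X" "Y \<le> real d" "real d < 2 * Y"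
        "1 \<le> a" "(real d)\<^sup>2 * real a \<le> real n powr c"
      using sq_pairsE[OF p(1) c(1) X] Y by (metis less_le_trans zero_less_one)
    have "Y\<^sup>2 * real a \<le> (real d)\<^sup>2 * real a" using da Y by (intro mult_right_mono power_mono) auto
    also have "\<dots> \<le> real n powr c" by (rule da)
    also have "\<dots> \<le> (2 * X) powr c" using da c by (intro powr_mono2) auto
    also have "\<dots> = 2 powr c * X powr c" using X by (simp add: powr_mult)
    also have "\<dots> \<le> 2 powr 2 * X powr c" using c by (intro mult_right_mono powr_mono) auto
    finally have "real a \<le> A" using Y by (simp add: A_def field_simps)
    thus "q \<in> ?D \<times> {1..nat \<lfloor>A\<rfloor>}" using da p by (auto simp: le_nat_floor)
  qed
  hence "card (sq_pairs c X Y) \<le> card (?D \<times> {1..nat \<lfloor>A\<rfloor>})"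
    using inj_on_cofactor[OF c(1) X] Y D by (intro card_inj_on_le) auto
  hence "real (card (sq_pairs c X Y)) \<le> real (card ?D) * real (nat \<lfloor>A\<rfloor>)"
    by (simp add: card_cartesian_product flip: of_nat_mult)
  also have "\<dots> \<le> (2 * Y) * A" using D Y by (intro mult_mono) (auto simp: A_def)
  also have "\<dots> = 8 * X powr c / Y" using Y by (simp add: A_def power2_eq_square)
  finally show ?thesis .
qed

text \<open>The curves \<open>a = n\<^sup>c / d\<^sup>2\<close> with parameter \<open>d\<close>. The bound \<open>\<theta> \<le> 0.571\<close> makes the exponents \<open>2c - 3 + \<theta>\<close> here and
  \<open>5c - 3 - 8\<theta>\<close> in the next lemma smaller than \<open>1\<close>.\<close>

lemma sq_pairs_small:
  assumes c: "1 < c" "c < 149 / 87" and eta: "0 < \<eta>" "\<eta> \<le> 3 / 10000" "6 * \<eta> \<le> \<epsilon>"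
  shows "\<exists>C. \<forall>\<^sub>F X in at_top. \<forall>\<theta>. \<epsilon> \<le> \<theta> \<and> \<theta> \<le> 571 / 1000 \<longrightarrow>
    real (card (sq_pairs c X (X powr \<theta>))) \<le> C * X powr (1 - \<eta>)"
proof -
  \<comment> \<open>Chosen so that \<delta> / curv = k * X^(2-c) below.\<close>
  define k where "k = 4 / (c * (c - 1))"
  have k: "0 < k" using c by (simp add: k_def)
  have "\<forall>\<^sub>F X in at_top. 1 + 10 * ln X \<le> X powr \<eta>" "\<forall>\<^sub>F X in at_top. 16 \<le> X powr (c - 1)"
    "\<forall>\<^sub>F X in at_top. 4 \<le> X powr (5 * \<eta>)" "\<forall>\<^sub>F X in at_top. 3 * (k * X powr (2 - c)) + 4 \<le> X powr 10"
    "\<forall>\<^sub>F X in at_top. (4 :: real) \<le> X"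
    using eta c by real_asymp+
  hence "\<forall>\<^sub>F X in at_top. \<forall>\<theta>. \<epsilon> \<le> \<theta> \<and> \<theta> \<le> 571 / 1000 \<longrightarrow>
    real (card (sq_pairs c X (X powr \<theta>))) \<le> (3840 * k + 48 + 24 * (196 + 1568 * k)) * X powr (1 - \<eta>)"
  proof eventually_elim
    case (elim X)
    show ?case
    proof (intro allI impI)
      fix \<theta> assume th: "\<epsilon> \<le> \<theta> \<and> \<theta> \<le> 571 / 1000"
      note L = elim(1)
      define Y where "Y = X powr \<theta>"
      have th0: "0 < \<theta>" using th eta by linarith
      have X4: "4 \<le> X" using elim by simp
      have Y1: "1 \<le> Y" unfolding Y_def using X4 th0 by (intro ge_one_powr_ge_zero) auto
      have mono: "X powr a \<le> X powr b" if "a \<le> b" for a b using that X4 by (intro powr_mono) auto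
      \<comment> \<open>This is the condition 4 \<delta> U <= 1 of \<open>card_points\<close> for
        \<delta> = 1 / Y^2 and U <= Y * X^eta; it rests on theta >= 6 eta.\<close>
      have Yeta: "4 * X powr \<eta> \<le> Y"
      proof -
        have "4 * X powr \<eta> \<le> X powr (5 * \<eta>) * X powr \<eta>" using elim by (intro mult_right_mono) auto
        also have "\<dots> = X powr (6 * \<eta>)" by (simp flip: powr_add)
        also have "\<dots> \<le> Y" unfolding Y_def using th eta by (intro mono) auto
        finally show ?thesis .
      qed
      define Ys where "Ys = {d::nat. Y \<le> real d \<and> real d \<le> 2 * Y}"
      have cardYs: "finite Ys" "real (card Ys) \<le> 2 * Y"
        using card_nat_Icc_le[of Y "2 * Y"] Y1 by (auto simp: Ys_def)
      have dpos: "0 < real d" "Y\<^sup>2 \<le> (real d)\<^sup>2" "(real d)\<^sup>2 \<le> 4 * Y\<^sup>2" if "d \<in> Ys" for d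
      proof -
        show "0 < real d" using that Y1 by (auto simp: Ys_def)
        show "Y\<^sup>2 \<le> (real d)\<^sup>2" using that Y1 by (auto simp: Ys_def intro!: power_mono)
        have "(real d)\<^sup>2 \<le> (2 * Y)\<^sup>2" using that Y1 by (intro power_mono) (auto simp: Ys_def)
        thus "(real d)\<^sup>2 \<le> 4 * Y\<^sup>2" by (simp add: power_mult_distrib)
      qed
      \<comment> \<open>The abscissa is n. For d in [Y, 2Y] the weights 1 / d^2 vary by a factor 4,
        and n^c / d^2 exceeds the integer a by less than 1 / d^2 <= 1 / Y^2.\<close>
      interpret convex_family c 4 X "1 / (4 * Y\<^sup>2)" Y "1 / Y\<^sup>2" Ys "\<lambda>d. 1 / (real d)\<^sup>2"
      proof
        fix y assume y: "y \<in> Ys"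
        show "1 / (4 * Y\<^sup>2) \<le> 1 / (real y)\<^sup>2"
          using dpos[OF y] Y1 by (intro divide_left_mono) auto
        show "1 / (real y)\<^sup>2 \<le> 4 * (1 / (4 * Y\<^sup>2))"
          using dpos[OF y] Y1 by (simp add: divide_simps)
        fix y' assume y': "y' \<in> Ys"
        have "\<bar>real y - real y'\<bar> \<le> 2 * Y * \<bar>ln (real y) - ln (real y')\<bar>"
          using y y' dpos[OF y] dpos[OF y'] by (intro ln_diff_ge) (auto simp: Ys_def)
        also have "2 * Y * \<bar>ln (real y) - ln (real y')\<bar> = Y * (2 * \<bar>ln (real y) - ln (real y')\<bar>)" by simp
        also have "2 * \<bar>ln (real y) - ln (real y')\<bar> = \<bar>2 * ln (real y) - 2 * ln (real y')\<bar>" by (auto simp: abs_if)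
        also have "\<bar>2 * ln (real y) - 2 * ln (real y')\<bar> = \<bar>ln (1 / (real y)\<^sup>2) - ln (1 / (real y')\<^sup>2)\<bar>"
          using dpos[OF y] dpos[OF y'] by (simp add: ln_div ln_realpow abs_minus_commute)
        finally show "\<bar>real y - real y'\<bar> \<le> Y * \<bar>ln (1 / (real y)\<^sup>2) - ln (1 / (real y')\<^sup>2)\<bar>" .
      next
        have "4 * 4 \<le> c * X powr (c - 1)"
        proof -
          have "1 * 16 \<le> c * X powr (c - 1)" using elim c by (intro mult_mono) auto
          thus ?thesis by simp
        qed
        thus "4 * (1 / Y\<^sup>2) \<le> c * (1 / (4 * Y\<^sup>2)) * X powr (c - 1)"
          using Y1 by (simp add: divide_simps)
      qed (use c X4 Y1 cardYs in auto)
      \<comment> \<open>There are about Y curves, so Y * X / U is X^(1-eta) up to a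
        constant.\<close>
      define U where "U = nat \<lfloor>X powr (\<theta> + \<eta>)\<rfloor>"
      have U1: "1 \<le> X powr (\<theta> + \<eta>)" using X4 th0 eta by (intro ge_one_powr_ge_zero) auto
      have U: "1 \<le> U" "real U \<le> X powr (\<theta> + \<eta>)" "X powr (\<theta> + \<eta>) / 2 \<le> real U"
        unfolding U_def by (rule nat_floor_bounds[OF U1])+
      have Y2: "1 / Y\<^sup>2 = X powr (- 2 * \<theta>)"
        by (simp add: Y_def powr_minus_divide flip: powr_add) (simp add: power2_eq_square flip: powr_add)
      have sl: "0 \<le> slope" "slope \<le> X powr (c - 1 - 2 * \<theta>)"
      proof -
        have "slope = c / 4 * (1 / Y\<^sup>2 * X powr (c - 1))" by (simp add: slope_def)
        also have "\<dots> = c / 4 * X powr (c - 1 - 2 * \<theta>)" unfolding Y2 by (simp flip: powr_add)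
        also have "\<dots> \<le> 1 * X powr (c - 1 - 2 * \<theta>)" using c by (intro mult_right_mono) auto
        finally show "slope \<le> X powr (c - 1 - 2 * \<theta>)" by simp
      qed (use slope_pos in simp)
      have cv: "curv = X powr (c - 2 - 2 * \<theta>) / k"
      proof -
        have "curv = c * (c - 1) / 4 * (1 / Y\<^sup>2 * X powr (c - 2))" by (simp add: curv_def)
        also have "\<dots> = c * (c - 1) / 4 * X powr (c - 2 - 2 * \<theta>)" unfolding Y2 by (simp flip: powr_add)
        finally show ?thesis by (simp add: k_def)
      qed
      have k1: "1 \<le> k"
      proof -
        have "c * (c - 1) \<le> 2 * 2" using c by (intro mult_mono) auto
        thus ?thesis using c by (simp add: k_def)
      qed
      have dc: "1 / Y\<^sup>2 / curv = k * X powr (2 - c)"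
      proof -
        have "1 / Y\<^sup>2 / curv = k * (X powr (- 2 * \<theta>) / X powr (c - 2 - 2 * \<theta>))" unfolding Y2 cv by simp
        also have "\<dots> = k * X powr (2 - c)" unfolding powr_diff[symmetric] by simp
        finally show ?thesis .
      qed
      have cvU: "curv * real U ^ 3 \<le> X powr (c - 2 + \<theta> + 3 * \<eta>)"
      proof -
        have "curv * real U ^ 3 \<le> X powr (c - 2 - 2 * \<theta>) * (X powr (\<theta> + \<eta>)) ^ 3"
        proof (intro mult_mono power_mono)
          show "curv \<le> X powr (c - 2 - 2 * \<theta>)" unfolding cv
            using mult_left_mono[OF k1, of "X powr (c - 2 - 2 * \<theta>)"] k by (simp add: divide_le_eq)
        qed (use U in auto)
        also have "\<dots> = X powr (c - 2 + \<theta> + 3 * \<eta>)"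
        proof -
          have "(X powr (\<theta> + \<eta>)) ^ 3 = X powr (\<theta> + \<eta> + (\<theta> + \<eta>) + (\<theta> + \<eta>))"
            by (simp only: power3_eq_cube powr_add)
          thus ?thesis by (simp add: algebra_simps flip: powr_add)
        qed
        finally show ?thesis .
      qed
      define Lg where "Lg = 1 + ln (X powr 10)"
      have Lg: "0 \<le> Lg" "Lg \<le> X powr \<eta>" using L X4 by (auto simp: Lg_def ln_realpow)
      have "real (card (sq_pairs c X Y)) \<le> real (\<Sum>y\<in>Ys. card (pts y))"
      proof -
        have "sq_pairs c X Y \<subseteq> Sigma Ys pts"
        proof
          fix p assume "p \<in> sq_pairs c X Y"
          then obtain d n a where p: "p = (d, n)" "X \<le> real n" "real n \<le> 2 * X" "Y \<le> real d" "real d < 2 * Y"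
            "(real d)\<^sup>2 * real a \<le> real n powr c" "real n powr c < (real d)\<^sup>2 * real a + 1"
            by (rule sq_pairsE) (use c X4 Y1 in auto)
          have d: "d \<in> Ys" using p by (simp add: Ys_def)
          note d' = dpos[OF d]
          have "\<bar>real n powr c - (real d)\<^sup>2 * real a\<bar> \<le> 1" using p by linarith
          hence "\<bar>(real n powr c - (real d)\<^sup>2 * real a) / (real d)\<^sup>2\<bar> \<le> 1 / (real d)\<^sup>2"
            using d'(1) by (simp add: divide_right_mono)
          also have "(real n powr c - (real d)\<^sup>2 * real a) / (real d)\<^sup>2 = 1 / (real d)\<^sup>2 * real n powr c - of_int (int a)"
            using d'(1) by (simp add: diff_divide_distrib)
          also have "1 / (real d)\<^sup>2 \<le> 1 / Y\<^sup>2" using d' Y1 by (intro divide_left_mono) auto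
          finally have "\<bar>1 / (real d)\<^sup>2 * real n powr c - of_int (int a)\<bar> \<le> 1 / Y\<^sup>2" .
          moreover have "\<bar>1 / (real d)\<^sup>2 * real n powr c - of_int (near d n)\<bar> \<le> \<bar>1 / (real d)\<^sup>2 * real n powr c - of_int (int a)\<bar>"
            unfolding near_def by (rule round_diff_minimal)
          ultimately have "n \<in> pts d" unfolding pts_def using p by auto
          thus "p \<in> Sigma Ys pts" using p d by simp
        qed
        hence "card (sq_pairs c X Y) \<le> card (Sigma Ys pts)"
          using cardYs by (intro card_mono) auto
        also have "\<dots> = (\<Sum>y\<in>Ys. card (pts y))" using cardYs by (intro card_SigmaI) auto
        finally show ?thesis by (simp only: of_nat_le_iff)
      qed
      also have "\<dots> \<le> real (card Ys) * (480 * 4 * slope * (1 / Y\<^sup>2 / curv) * (1 + ln (X powr 10)) + 12 * X / real U)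
          + 6 * 4 * slope * real U * (4 * curv * real U ^ 3 + 48 * 4 * Y * (1 / Y\<^sup>2) * real U * (1 + ln (X powr 10)))
            * (real U + 8 * (1 / Y\<^sup>2) / curv * (1 + ln (X powr 10)))"
      proof (rule card_points)
        have "X powr (\<theta> + \<eta>) \<le> X powr 1" using th eta by (intro mono) auto
        thus "real U \<le> X" using U X4 by simp
        have "X powr 1 \<le> X powr 10" by (intro mono) auto
        thus "real U \<le> X powr 10" using \<open>real U \<le> X\<close> X4 by simp
        have "4 * (1 / Y\<^sup>2) * real U \<le> 4 * (1 / Y\<^sup>2) * (X powr \<theta> * X powr \<eta>)"
          using U by (intro mult_left_mono) (auto simp: powr_add)
        also have "\<dots> = (4 * X powr \<eta>) / Y" using Y1 by (simp add: Y_def[symmetric] power2_eq_square)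
        also have "\<dots> \<le> 1" using Yeta Y1 by simp
        finally show "4 * (1 / Y\<^sup>2) * real U \<le> 1" .
        show "3 * (1 / Y\<^sup>2 / curv) + 4 \<le> X powr 10" unfolding dc using elim by simp
        have "4 * (curv * real U ^ 3) \<le> X powr 1 * X powr (c - 2 + \<theta> + 3 * \<eta>)"
          using cvU X4 curv_pos by (intro mult_mono) auto
        also have "\<dots> \<le> X powr 10" unfolding powr_add[symmetric] using th eta c by (intro mono) auto
        finally show "4 * curv * real U ^ 3 \<le> X powr 10" by simp
      qed (use U in auto)
      also have "\<dots> = real (card Ys) * (1920 * slope * (k * X powr (2 - c)) * Lg + 12 * X / real U)
          + 24 * slope * real U * (4 * (curv * real U ^ 3) + 192 * (1 / Y) * real U * Lg)
            * (real U + 8 * (k * X powr (2 - c)) * Lg)"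
        unfolding dc[symmetric] Lg_def using Y1 by (simp add: power2_eq_square mult.assoc)
      also have "\<dots> \<le> (2 * X powr \<theta>) * (1920 * X powr (c - 1 - 2 * \<theta>) * (k * X powr (2 - c)) * X powr \<eta> + 12 * X / (X powr (\<theta> + \<eta>) / 2))
          + 24 * X powr (c - 1 - 2 * \<theta>) * X powr (\<theta> + \<eta>) * (4 * X powr (c - 2 + \<theta> + 3 * \<eta>) + 192 * X powr (- \<theta>) * X powr (\<theta> + \<eta>) * X powr \<eta>)
            * (X powr (\<theta> + \<eta>) + 8 * (k * X powr (2 - c)) * X powr \<eta>)"
      proof -
        have Yi: "1 / Y = X powr (- \<theta>)" by (simp add: Y_def powr_minus_divide)
        have "real (card Ys) \<le> 2 * X powr \<theta>" using cardYs by (simp add: Y_def)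
        thus ?thesis unfolding Yi
          using sl U Lg k cvU curv_pos X4
          by (intro add_mono mult_mono divide_left_mono mult_nonneg_nonneg add_nonneg_nonneg mult_pos_pos) auto
      qed
      also have "\<dots> = 3840 * k * X powr (1 - \<theta> + \<eta>) + 48 * X powr (1 - \<eta>)
          + 24 * (4 * X powr (2 * c - 3 + \<theta> + 5 * \<eta>) + 192 * X powr (c - 1 + 4 * \<eta>)
             + 32 * k * X powr (c - 1 + 5 * \<eta>) + 1536 * k * X powr (1 - \<theta> + 4 * \<eta>))"
      proof -
        \<comment> \<open>The product is expanded with a free real in place of each power of X;
          exponents are added afterwards.\<close>
        have ring: "(2 * t) * (1920 * p1 * (k * p7) * p6 + 12 * X / (p2 / 2))
            + 24 * p1 * p2 * (4 * p3 + 192 * p4 * p2 * p6) * (p2 + 8 * (k * p7) * p6)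
            = 3840 * k * (t * p1 * p7 * p6) + 48 * (t * X / p2)
            + 24 * (4 * (p1 * p2 * p3 * p2) + 192 * (p1 * p2 * p4 * p2 * p6 * p2)
               + 32 * k * (p1 * p2 * p3 * p7 * p6) + 1536 * k * (p1 * p2 * p4 * p2 * p6 * p7 * p6))"
          for t p1 p2 p3 p4 p6 p7 :: real
          by (simp add: algebra_simps)
        have "X powr \<theta> * X / X powr (\<theta> + \<eta>) = X powr \<theta> * X powr 1 / X powr (\<theta> + \<eta>)" using X4 by simp
        also have "\<dots> = X powr (1 - \<eta>)" unfolding powr_add[symmetric] powr_diff[symmetric] by simp
        finally have d: "X powr \<theta> * X / X powr (\<theta> + \<eta>) = X powr (1 - \<eta>)" .
        have e: "X powr \<theta> * X powr (c - 1 - 2 * \<theta>) * X powr (2 - c) * X powr \<eta> = X powr (1 - \<theta> + \<eta>)"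
          "X powr (c - 1 - 2 * \<theta>) * X powr (\<theta> + \<eta>) * X powr (c - 2 + \<theta> + 3 * \<eta>) * X powr (\<theta> + \<eta>) = X powr (2 * c - 3 + \<theta> + 5 * \<eta>)"
          "X powr (c - 1 - 2 * \<theta>) * X powr (\<theta> + \<eta>) * X powr (- \<theta>) * X powr (\<theta> + \<eta>) * X powr \<eta> * X powr (\<theta> + \<eta>) = X powr (c - 1 + 4 * \<eta>)"
          "X powr (c - 1 - 2 * \<theta>) * X powr (\<theta> + \<eta>) * X powr (c - 2 + \<theta> + 3 * \<eta>) * X powr (2 - c) * X powr \<eta> = X powr (c - 1 + 5 * \<eta>)"
          "X powr (c - 1 - 2 * \<theta>) * X powr (\<theta> + \<eta>) * X powr (- \<theta>) * X powr (\<theta> + \<eta>) * X powr \<eta> * X powr (2 - c) * X powr \<eta> = X powr (1 - \<theta> + 4 * \<eta>)"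
          unfolding powr_add[symmetric] by (rule arg_cong[where f = "\<lambda>z. X powr z"], simp)+
        show ?thesis unfolding ring d e ..
      qed
      \<comment> \<open>The tightest exponent is 2c - 3 + theta + 5 eta: at c = 149/87 and theta =
        571/1000 about 0.0037 is left for 6 eta <= 0.0018. The exponents containing 1 - theta need
        theta >= 6 eta.\<close>
      also have "\<dots> \<le> 3840 * k * X powr (1 - \<eta>) + 48 * X powr (1 - \<eta>)
          + 24 * (4 * X powr (1 - \<eta>) + 192 * X powr (1 - \<eta>)
             + 32 * k * X powr (1 - \<eta>) + 1536 * k * X powr (1 - \<eta>))"
        using k th eta c by (intro add_mono mult_left_mono mono) auto
      also have "\<dots> \<le> (3840 * k + 48 + 24 * (196 + 1568 * k)) * X powr (1 - \<eta>)"
        using k by (simp add: algebra_simps)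
      finally show "real (card (sq_pairs c X (X powr \<theta>))) \<le> (3840 * k + 48 + 24 * (196 + 1568 * k)) * X powr (1 - \<eta>)"
        by (simp add: Y_def)
    qed
  qed
  thus ?thesis by blast
qed

text \<open>The curves \<open>n = (a d\<^sup>2)\<^sup>1\<^sup>/\<^sup>c\<close> with parameter \<open>a\<close>.\<close>

lemma sq_pairs_medium:
  assumes c: "1 < c" "c < 149 / 87" and eta: "0 < \<eta>" "\<eta> \<le> 3 / 10000"
  shows "\<exists>C. \<forall>\<^sub>F X in at_top. \<forall>\<theta>. 571 / 1000 \<le> \<theta> \<and> \<theta> \<le> c - 1 + \<eta> \<longrightarrow>
    real (card (sq_pairs c X (X powr \<theta>))) \<le> C * X powr (1 - \<eta>)"
proof -
  \<comment> \<open>Here 2 / k = (2 / c - 1) / 8, where 1/8 is a lower bound for the factor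
    (1/8)^(1/c) that the weight \<open>W\<close> brings into \<open>curv\<close>.\<close>
  define k where "k = 16 / (2 / c - 1)"
  have c2: "c < 2" "0 < 2 / c - 1" "2 / c - 1 \<le> 1" using c by (auto simp: field_simps)
  have k: "16 \<le> k" using c2 by (simp add: k_def field_simps)
  have "\<forall>\<^sub>F X in at_top. 1 + 10 * ln X \<le> X powr \<eta>" "\<forall>\<^sub>F X in at_top. 64 \<le> X powr (1 - \<eta>)"
    "\<forall>\<^sub>F X in at_top. (8 :: real) \<le> X powr (1 / 2)" "\<forall>\<^sub>F X in at_top. 3 * (k * X powr 1) + 4 \<le> X powr 10"
    "\<forall>\<^sub>F X in at_top. (64 :: real) \<le> X"
    using eta by real_asymp+
  hence "\<forall>\<^sub>F X in at_top. \<forall>\<theta>. 571 / 1000 \<le> \<theta> \<and> \<theta> \<le> c - 1 + \<eta> \<longrightarrow>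
    real (card (sq_pairs c X (X powr \<theta>))) \<le> (153600 * k + 120 + 384 * 64 * (1 + 8 * k) + 384 * 24576 * (1 + 8 * k)) * X powr (1 - \<eta>)"
  proof eventually_elim
    case (elim X)
    show ?case
    proof (intro allI impI)
      fix \<theta> assume th: "571 / 1000 \<le> \<theta> \<and> \<theta> \<le> c - 1 + \<eta>"
      note L = elim(1)
      define Y where "Y = X powr \<theta>"
      \<comment> \<open>a * d^2 lies between X^c / 2 and 4 X^c, and d^2 between Y^2 and 4 Y^2; hence
        a lies in [A, 32 A].\<close>
      define A where "A = X powr (c - 2 * \<theta>) / 8"
      have X4: "64 \<le> X" using elim by simp
      have mono: "X powr a \<le> X powr b" if "a \<le> b" for a b using that X4 by (intro powr_mono) auto
      have pos: "1 \<le> X powr a" if "0 \<le> a" for a using that X4 by (intro ge_one_powr_ge_zero) auto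
      have Y1: "1 \<le> Y" unfolding Y_def using th by (intro pos) auto
      have A0: "0 < A" using X4 by (simp add: A_def)
      define Ys where "Ys = {a::nat. A \<le> real a \<and> real a \<le> 32 * A}"
      have cardYs: "finite Ys" "real (card Ys) \<le> 5 * X powr (c - 2 * \<theta>)"
      proof -
        have "1 \<le> X powr (c - 2 * \<theta>)" using th c eta by (intro pos) auto
        thus "finite Ys" "real (card Ys) \<le> 5 * X powr (c - 2 * \<theta>)"
          using card_nat_Icc_le[of A "32 * A"] A0 by (auto simp: Ys_def A_def)
      qed
      define g where "g = 1 / c"
      have g: "0 < g" "g \<le> 1" "1 / 2 < g" "2 * g = 2 / c" "c * g = 1" using c by (auto simp: g_def field_simps)
      have apos: "0 < real a" if "a \<in> Ys" for a using that A0 by (auto simp: Ys_def)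
      define W where "W = A powr g"
      have p8: "1 / 8 \<le> (1 / 8) powr g" "(1 / 8 :: real) powr g \<le> 1"
      proof -
        have "(1 / 8 :: real) powr 1 \<le> (1 / 8) powr g" using g by (intro powr_mono') auto
        thus "1 / 8 \<le> (1 / 8 :: real) powr g" by simp
        show "(1 / 8 :: real) powr g \<le> 1" using g by (intro powr_le1) auto
      qed
      have W_eq: "W = (1 / 8) powr g * X powr (1 - 2 * \<theta> * g)"
      proof -
        have "W = (1 / 8 * X powr (c - 2 * \<theta>)) powr g" by (simp add: W_def A_def)
        also have "\<dots> = (1 / 8) powr g * (X powr (c - 2 * \<theta>)) powr g" by (rule powr_mult)
        also have "(X powr (c - 2 * \<theta>)) powr g = X powr (1 - 2 * \<theta> * g)"
          using g(5) by (simp add: powr_powr left_diff_distrib)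
        finally show ?thesis .
      qed
      \<comment> \<open>The abscissa is now d and the ordinate n, on the curve a^(1/c) * d^(2/c),
        with 1 < 2/c < 2 because 1 < c < 2. The separation constant is 64 A, the factor 2 over 32 A
        coming from 1/c > 1/2.\<close>
      interpret convex_family "2 / c" 32 Y W "8 * X powr (c - 2 * \<theta>)" "2 * X powr (1 - c)" Ys "\<lambda>a. real a powr g"
      proof
        fix y assume y: "y \<in> Ys"
        show "W \<le> real y powr g"
          unfolding W_def using y A0 g by (intro powr_mono2) (auto simp: Ys_def)
        have "real y powr g \<le> (32 * A) powr g" using y A0 g by (intro powr_mono2) (auto simp: Ys_def)
        also have "\<dots> = 32 powr g * W" using A0 by (simp add: powr_mult W_def)
        also have "\<dots> \<le> 32 powr 1 * W" using g by (intro mult_right_mono powr_mono) (auto simp: W_def)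
        finally show "real y powr g \<le> 32 * W" by simp
        fix y' assume y': "y' \<in> Ys"
        have "\<bar>real y - real y'\<bar> \<le> 32 * A * \<bar>ln (real y) - ln (real y')\<bar>"
          using y y' apos[OF y] apos[OF y'] by (intro ln_diff_ge) (auto simp: Ys_def)
        also have "\<dots> \<le> (2 * g) * (32 * A * \<bar>ln (real y) - ln (real y')\<bar>)"
          using g A0 by (intro mult_right_mono[of 1 "2 * g", simplified]) auto
        also have "\<dots> = 64 * A * (g * \<bar>ln (real y) - ln (real y')\<bar>)" by simp
        also have "64 * A = 8 * X powr (c - 2 * \<theta>)" by (simp add: A_def)
        also have "g * \<bar>ln (real y) - ln (real y')\<bar> = \<bar>g * (ln (real y) - ln (real y'))\<bar>"
          using g by (simp add: abs_mult)
        also have "g * (ln (real y) - ln (real y')) = ln (real y powr g) - ln (real y' powr g)"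
          using apos[OF y] apos[OF y'] by (simp add: ln_powr right_diff_distrib)
        finally show "\<bar>real y - real y'\<bar> \<le> 8 * X powr (c - 2 * \<theta>) * \<bar>ln (real y powr g) - ln (real y' powr g)\<bar>" .
      next
        have "Y powr (2 / c - 1) = X powr (\<theta> * (2 * g - 1))" by (simp add: Y_def powr_powr g)
        hence "2 / c * W * Y powr (2 / c - 1) = 2 / c * (1 / 8) powr g * (X powr (1 - 2 * \<theta> * g) * X powr (\<theta> * (2 * g - 1)))"
          unfolding W_eq by simp
        also have "X powr (1 - 2 * \<theta> * g) * X powr (\<theta> * (2 * g - 1)) = X powr (1 - \<theta>)"
          unfolding powr_add[symmetric] by (simp add: algebra_simps)
        finally have s: "2 / c * W * Y powr (2 / c - 1) = 2 / c * (1 / 8) powr g * X powr (1 - \<theta>)" .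
        have "8 * X powr (1 - c) \<le> X powr (1 - \<eta>) / 8 * X powr (1 - c)"
          using elim by (intro mult_right_mono) auto
        also have "\<dots> = 1 * (1 / 8) * X powr (1 - \<eta> + (1 - c))"
          unfolding powr_add[of X "1 - \<eta>" "1 - c"] by simp
        also have "\<dots> \<le> 2 / c * (1 / 8) powr g * X powr (1 - \<theta>)"
          using c c2 p8 th by (intro mult_mono mono) auto
        finally show "4 * (2 * X powr (1 - c)) \<le> 2 / c * W * Y powr (2 / c - 1)" unfolding s by simp
      qed (use c c2 X4 Y1 cardYs A0 in \<open>auto simp: W_def field_simps\<close>)
      \<comment> \<open>Chosen so that (number of curves) * Y / U has exponent (c - 2 theta) + theta
        - \<mu> = 1 - 2 eta. The upper limit for theta gives \<mu> >= eta, so U is at least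
        1.\<close>
      define \<mu> where "\<mu> = c - 1 + 2 * \<eta> - \<theta>"
      have mu: "\<eta> \<le> \<mu>" using th by (simp add: \<mu>_def)
      define U where "U = nat \<lfloor>X powr \<mu>\<rfloor>"
      have U1: "1 \<le> X powr \<mu>" using mu eta by (intro pos) auto
      have U: "1 \<le> U" "real U \<le> X powr \<mu>" "X powr \<mu> / 2 \<le> real U"
        unfolding U_def by (rule nat_floor_bounds[OF U1])+
      have sl: "0 \<le> slope" "slope \<le> 2 * X powr (1 - \<theta>)"
      proof -
        have "Y powr (2 / c - 1) = X powr (\<theta> * (2 * g - 1))" by (simp add: Y_def powr_powr g)
        hence "slope = 2 / c * (1 / 8) powr g * (X powr (1 - 2 * \<theta> * g) * X powr (\<theta> * (2 * g - 1)))"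
          unfolding slope_def unfolding W_eq by simp
        also have "X powr (1 - 2 * \<theta> * g) * X powr (\<theta> * (2 * g - 1)) = X powr (1 - \<theta>)"
          unfolding powr_add[symmetric] by (simp add: algebra_simps)
        also have "2 / c * (1 / 8) powr g * X powr (1 - \<theta>) \<le> 2 * 1 * X powr (1 - \<theta>)"
          using c p8 by (intro mult_mono) (auto simp: field_simps)
        finally show "slope \<le> 2 * X powr (1 - \<theta>)" by simp
      qed (use slope_pos in simp)
      have cv: "curv \<le> 2 * X powr (1 - 2 * \<theta>)" "2 / k * X powr (1 - 2 * \<theta>) \<le> curv"
      proof -
        have "Y powr (2 / c - 2) = X powr (\<theta> * (2 * g - 2))" by (simp add: Y_def powr_powr g)
        hence "curv = 2 / c * (2 / c - 1) * (1 / 8) powr g * (X powr (1 - 2 * \<theta> * g) * X powr (\<theta> * (2 * g - 2)))"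
          unfolding curv_def unfolding W_eq by simp
        also have "X powr (1 - 2 * \<theta> * g) * X powr (\<theta> * (2 * g - 2)) = X powr (1 - 2 * \<theta>)"
          unfolding powr_add[symmetric] by (simp add: algebra_simps)
        finally have e: "curv = 2 / c * (2 / c - 1) * (1 / 8) powr g * X powr (1 - 2 * \<theta>)" .
        have up: "b * (b - 1) * q * P \<le> 2 * 1 * 1 * P" if "1 < b" "b \<le> 2" "0 \<le> q" "q \<le> 1" "0 \<le> P" for b q P :: real
          using that by (intro mult_mono mult_nonneg_nonneg) auto
        have low: "1 * (b - 1) * (1 / 8) * P \<le> b * (b - 1) * q * P" if "1 < b" "1 / 8 \<le> q" "0 \<le> P" for b q P :: real
          using that by (intro mult_mono mult_nonneg_nonneg) auto
        show "curv \<le> 2 * X powr (1 - 2 * \<theta>)"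
          unfolding e using up[of "2 / c" "(1 / 8) powr g" "X powr (1 - 2 * \<theta>)"] c2 p8 by simp
        have "1 * (2 / c - 1) * (1 / 8) * X powr (1 - 2 * \<theta>) \<le> 2 / c * (2 / c - 1) * (1 / 8) powr g * X powr (1 - 2 * \<theta>)"
          using c2 p8 by (intro low) auto
        moreover have kk: "2 / k = 1 * (2 / c - 1) * (1 / 8)" by (simp add: k_def)
        ultimately show "2 / k * X powr (1 - 2 * \<theta>) \<le> curv" unfolding e kk by (simp only:)
      qed
      have dc: "2 * X powr (1 - c) / curv \<le> k * X powr (2 * \<theta> - c)"
      proof -
        have "2 * X powr (1 - c) / curv \<le> 2 * X powr (1 - c) / (2 / k * X powr (1 - 2 * \<theta>))"
          using cv k X4 curv_pos by (intro divide_left_mono mult_pos_pos) auto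
        also have "\<dots> = k * (X powr (1 - c) / X powr (1 - 2 * \<theta>))" by simp
        also have "\<dots> = k * X powr (2 * \<theta> - c)" unfolding powr_diff[symmetric] by simp
        finally show ?thesis .
      qed
      have cvU: "curv * real U ^ 3 \<le> 2 * X powr (1 - 2 * \<theta> + 3 * \<mu>)"
      proof -
        have "curv * real U ^ 3 \<le> 2 * X powr (1 - 2 * \<theta>) * (X powr \<mu>) ^ 3"
          using cv U by (intro mult_mono power_mono) auto
        also have "(X powr \<mu>) ^ 3 = X powr (\<mu> + \<mu> + \<mu>)"
          by (simp only: power3_eq_cube powr_add)
        also have "2 * X powr (1 - 2 * \<theta>) * X powr (\<mu> + \<mu> + \<mu>) = 2 * X powr (1 - 2 * \<theta> + 3 * \<mu>)"
          by (simp flip: powr_add)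
        finally show ?thesis .
      qed
      define Lg where "Lg = 1 + ln (X powr 10)"
      have Lg: "0 \<le> Lg" "Lg \<le> X powr \<eta>" using L X4 by (auto simp: Lg_def ln_realpow)
      have "real (card (sq_pairs c X Y)) \<le> real (\<Sum>y\<in>Ys. card (pts y))"
      proof -
        \<comment> \<open>The swap puts the parameter a before the abscissa d.\<close>
        have "(prod.swap \<circ> cofactor c) ` sq_pairs c X Y \<subseteq> Sigma Ys pts"
        proof
          fix q assume "q \<in> (prod.swap \<circ> cofactor c) ` sq_pairs c X Y"
          then obtain p where q: "q = prod.swap (cofactor c p)" "p \<in> sq_pairs c X Y" by auto
          from q(2) obtain d n a where p: "p = (d, n)" "cofactor c p = (d, a)" "X \<le> real n" "real n \<le> 2 * X" "Y \<le> real d" "real d < 2 * Y"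
            "1 \<le> a" "(real d)\<^sup>2 * real a \<le> real n powr c" "real n powr c < (real d)\<^sup>2 * real a + 1"
            by (rule sq_pairsE) (use c X4 Y1 in auto)
          have n: "X powr c \<le> real n powr c" "real n powr c \<le> 4 * X powr c"
          proof -
            show "X powr c \<le> real n powr c" using p X4 c by (intro powr_mono2) auto
            have "real n powr c \<le> (2 * X) powr c" using p X4 c by (intro powr_mono2) auto
            also have "\<dots> = 2 powr c * X powr c" using X4 by (simp add: powr_mult)
            also have "\<dots> \<le> 2 powr 2 * X powr c" using c2 by (intro mult_right_mono powr_mono) auto
            finally show "real n powr c \<le> 4 * X powr c" by simp
          qed
          have Xc: "2 \<le> X powr c"
          proof -
            have "X powr 1 \<le> X powr c" using c by (intro mono) auto
            thus ?thesis using X4 by simp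
          qed
          define P where "P = (real d)\<^sup>2 * real a"
          have P: "X powr c / 2 \<le> P" "P \<le> real n powr c" "real n powr c \<le> P + 1" "P \<le> 4 * X powr c" "0 < P"
            using p n Xc by (auto simp: P_def)
          have Ysq: "X powr c = 8 * (A * Y\<^sup>2)"
            by (simp add: A_def Y_def power2_eq_square flip: powr_add)
          have "a \<in> Ys"
          proof -
            have "Y\<^sup>2 \<le> (real d)\<^sup>2" "(real d)\<^sup>2 \<le> (2 * Y)\<^sup>2" using p Y1 by (intro power_mono; simp)+
            hence "P \<le> 4 * Y\<^sup>2 * real a" "Y\<^sup>2 * real a \<le> P"
              unfolding P_def by (auto intro!: mult_right_mono)
            hence "A * Y\<^sup>2 \<le> real a * Y\<^sup>2" "real a * Y\<^sup>2 \<le> 32 * A * Y\<^sup>2"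
              using P(1,4) unfolding Ysq by (auto simp: mult_ac)
            thus ?thesis using Y1 by (simp add: Ys_def)
          qed
          have z: "real a powr g * real d powr (2 / c) = P powr g"
          proof -
            have "P powr g = ((real d)\<^sup>2) powr g * real a powr g" unfolding P_def by (rule powr_mult)
            also have "((real d)\<^sup>2) powr g = real d powr (2 * g)"
              using p Y1 by (simp add: powr_powr flip: powr_numeral)
            finally show ?thesis unfolding g(4) by (simp only: mult.commute)
          qed
          have nn: "real n = (real n powr c) powr g" using p X4 g by (simp add: powr_powr)
          have lo: "P powr g \<le> real n"
            by (subst nn) (use P g in \<open>intro powr_mono2, auto\<close>)
          have "real n \<le> (P + 1) powr g"
            by (subst nn) (use P g in \<open>intro powr_mono2, auto\<close>)
          \<comment> \<open>The tolerance of this family: n^c lies in [P, P + 1] with P >= X^c / 2,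
            where z^(1/c) has derivative at most 2 X^(1-c).\<close>
          moreover have "(P + 1) powr g - P powr g \<le> 2 * X powr (1 - c)"
          proof -
            have "P < P + 1" by simp
            with \<open>0 < P\<close> obtain s where s: "P < s" "s < P + 1" "(P + 1) powr g - P powr g = (P + 1 - P) * (g * s powr (g - 1))"
              by (rule powr_mvt)
            have "s powr (g - 1) \<le> (X powr c / 2) powr (g - 1)"
              using s P Xc g by (intro powr_mono2') auto
            also have "\<dots> = (X powr c) powr (g - 1) * (1 / 2) powr (g - 1)"
              using powr_mult[of "X powr c" "1 / 2" "g - 1"] by simp
            also have "(X powr c) powr (g - 1) = X powr (1 - c)"
              using g by (simp add: powr_powr right_diff_distrib)
            also have "X powr (1 - c) * (1 / 2) powr (g - 1) \<le> X powr (1 - c) * (1 / 2) powr (- 1)"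
              using g by (intro mult_left_mono powr_mono') auto
            finally have "s powr (g - 1) \<le> 2 * X powr (1 - c)" by (simp add: powr_minus mult.commute)
            moreover have "g * s powr (g - 1) \<le> 1 * s powr (g - 1)" using g by (intro mult_right_mono) auto
            ultimately show ?thesis using s(3) by simp
          qed
          ultimately have "\<bar>real a powr g * real d powr (2 / c) - of_int (int n)\<bar> \<le> 2 * X powr (1 - c)"
            unfolding z using lo by simp
          moreover have "\<bar>real a powr g * real d powr (2 / c) - of_int (near a d)\<bar>
              \<le> \<bar>real a powr g * real d powr (2 / c) - of_int (int n)\<bar>"
            unfolding near_def by (rule round_diff_minimal)
          ultimately have "d \<in> pts a" unfolding pts_def using p by auto
          thus "q \<in> Sigma Ys pts" using q p \<open>a \<in> Ys\<close> by simp
        qed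
        moreover have "inj_on (prod.swap \<circ> cofactor c) (sq_pairs c X Y)"
          using inj_on_cofactor[of c X Y] c X4 Y1 by (intro comp_inj_on) auto
        moreover have "finite (Sigma Ys pts)" using cardYs by auto
        ultimately have "card (sq_pairs c X Y) \<le> card (Sigma Ys pts)"
          by (metis card_inj_on_le)
        also have "\<dots> = (\<Sum>y\<in>Ys. card (pts y))" using cardYs by (intro card_SigmaI) auto
        finally show ?thesis by (simp only: of_nat_le_iff)
      qed
      also have "\<dots> \<le> real (card Ys) * (480 * 32 * slope * (2 * X powr (1 - c) / curv) * (1 + ln (X powr 10)) + 12 * Y / real U)
          + 6 * 32 * slope * real U * (32 * curv * real U ^ 3 + 48 * 32 * (8 * X powr (c - 2 * \<theta>)) * (2 * X powr (1 - c)) * real U * (1 + ln (X powr 10)))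
            * (real U + 8 * (2 * X powr (1 - c)) / curv * (1 + ln (X powr 10)))"
      proof (rule card_points)
        have "X powr \<mu> \<le> Y" unfolding Y_def \<mu>_def using th eta c by (intro mono) auto
        thus "real U \<le> Y" using U by simp
        have "X powr \<mu> \<le> X powr 10" unfolding \<mu>_def using th eta c by (intro mono) auto
        thus "real U \<le> X powr 10" using U by simp
        have "4 * (2 * X powr (1 - c)) * real U \<le> 8 * X powr (1 - c) * X powr \<mu>"
          using U by (simp add: mult_left_mono)
        also have "\<dots> = 8 * X powr (1 - c + \<mu>)" unfolding powr_add[of X "1 - c" \<mu>] by simp
        also have "\<dots> \<le> X powr (1 / 2) * X powr (1 - c + \<mu>)" using elim by (intro mult_right_mono) auto
        also have "\<dots> = X powr (1 / 2 + (1 - c + \<mu>))" by (rule powr_add[symmetric])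
        also have "\<dots> \<le> X powr 0" unfolding \<mu>_def using th eta by (intro mono) auto
        finally show "4 * (2 * X powr (1 - c)) * real U \<le> 1" using X4 by simp
        have "k * X powr (2 * \<theta> - c) \<le> k * X powr 1" using k th c eta by (intro mult_left_mono mono) auto
        hence "2 * X powr (1 - c) / curv \<le> k * X powr 1" using dc by linarith
        thus "3 * (2 * X powr (1 - c) / curv) + 4 \<le> X powr 10" using elim by linarith
        have "32 * (curv * real U ^ 3) \<le> X powr 1 * X powr (1 - 2 * \<theta> + 3 * \<mu>)"
        proof -
          have "32 * (curv * real U ^ 3) \<le> 64 * X powr (1 - 2 * \<theta> + 3 * \<mu>)" using cvU by linarith
          also have "\<dots> \<le> X powr 1 * X powr (1 - 2 * \<theta> + 3 * \<mu>)" using X4 by (intro mult_right_mono) auto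
          finally show ?thesis .
        qed
        also have "\<dots> \<le> X powr 10" unfolding powr_add[symmetric] \<mu>_def using th eta c by (intro mono) auto
        finally show "32 * curv * real U ^ 3 \<le> X powr 10" by simp
      qed (use U in auto)
      also have "\<dots> = real (card Ys) * (15360 * slope * (2 * X powr (1 - c) / curv) * Lg + 12 * Y / real U)
          + 192 * slope * real U * (32 * (curv * real U ^ 3) + 24576 * X powr (c - 2 * \<theta>) * X powr (1 - c) * real U * Lg)
            * (real U + 8 * (2 * X powr (1 - c) / curv) * Lg)"
        unfolding Lg_def by (simp add: mult.assoc)
      also have "\<dots> \<le> (5 * X powr (c - 2 * \<theta>)) * (15360 * (2 * X powr (1 - \<theta>)) * (k * X powr (2 * \<theta> - c)) * X powr \<eta> + 12 * X powr \<theta> / (X powr \<mu> / 2))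
          + 192 * (2 * X powr (1 - \<theta>)) * X powr \<mu> * (32 * (2 * X powr (1 - 2 * \<theta> + 3 * \<mu>)) + 24576 * X powr (c - 2 * \<theta>) * X powr (1 - c) * X powr \<mu> * X powr \<eta>)
            * (X powr \<mu> + 8 * (k * X powr (2 * \<theta> - c)) * X powr \<eta>)"
      proof -
        define V where "V = curv * real U ^ 3"
        have V: "0 \<le> V" "V \<le> 2 * X powr (1 - 2 * \<theta> + 3 * \<mu>)" using cvU curv_pos by (simp_all add: V_def)
        have YX: "0 \<le> Y" "Y \<le> X powr \<theta>" by (simp_all add: Y_def)
        show ?thesis
          unfolding V_def[symmetric] using YX V sl U Lg k dc cardYs curv_pos X4
          by (intro add_mono mult_mono frac_le mult_nonneg_nonneg add_nonneg_nonneg mult_pos_pos) auto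
      qed
      also have "\<dots> = 153600 * k * X powr (1 - \<theta> + \<eta>) + 120 * X powr (1 - 2 * \<eta>)
          + 384 * (64 * X powr (2 - 3 * \<theta> + 5 * \<mu>) + 24576 * X powr (2 - 3 * \<theta> + 3 * \<mu> + \<eta>)
             + 512 * k * X powr (2 - \<theta> - c + 4 * \<mu> + \<eta>) + 196608 * k * X powr (2 - \<theta> - c + 2 * \<mu> + 2 * \<eta>))"
      proof -
        have ring: "(5 * y) * (15360 * (2 * s) * (k * q) * e + 12 * t / (m / 2))
            + 192 * (2 * s) * m * (32 * (2 * v) + 24576 * y * d * m * e) * (m + 8 * (k * q) * e)
            = 153600 * k * (y * s * q * e) + 120 * (y * t / m)
            + 384 * (64 * (s * m * v * m) + 24576 * (s * m * y * d * m * e * m)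
               + 512 * k * (s * m * v * q * e) + 196608 * k * (s * m * y * d * m * e * q * e))"
          for y s q e t m v d :: real
          by (simp add: algebra_simps)
        have "X powr (c - 2 * \<theta>) * X powr \<theta> / X powr \<mu> = X powr (1 - 2 * \<eta>)"
          unfolding powr_add[symmetric] powr_diff[symmetric] \<mu>_def by simp
        moreover have
          "X powr (c - 2 * \<theta>) * X powr (1 - \<theta>) * X powr (2 * \<theta> - c) * X powr \<eta> = X powr (1 - \<theta> + \<eta>)"
          "X powr (1 - \<theta>) * X powr \<mu> * X powr (1 - 2 * \<theta> + 3 * \<mu>) * X powr \<mu> = X powr (2 - 3 * \<theta> + 5 * \<mu>)"
          "X powr (1 - \<theta>) * X powr \<mu> * X powr (c - 2 * \<theta>) * X powr (1 - c) * X powr \<mu> * X powr \<eta> * X powr \<mu>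
            = X powr (2 - 3 * \<theta> + 3 * \<mu> + \<eta>)"
          "X powr (1 - \<theta>) * X powr \<mu> * X powr (1 - 2 * \<theta> + 3 * \<mu>) * X powr (2 * \<theta> - c) * X powr \<eta>
            = X powr (2 - \<theta> - c + 4 * \<mu> + \<eta>)"
          "X powr (1 - \<theta>) * X powr \<mu> * X powr (c - 2 * \<theta>) * X powr (1 - c) * X powr \<mu> * X powr \<eta> * X powr (2 * \<theta> - c) * X powr \<eta>
            = X powr (2 - \<theta> - c + 2 * \<mu> + 2 * \<eta>)"
          unfolding powr_add[symmetric] by (rule arg_cong[where f = "\<lambda>z. X powr z"], simp)+
        ultimately show ?thesis unfolding ring by (simp only:)
      qed
      \<comment> \<open>The tightest exponent is 2 - 3 theta + 5 \<mu> = 5c - 3 - 8 theta + 10 eta: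
        at c = 149/87 and theta = 571/1000 about 0.0047 is left for 11 eta <= 0.0033.\<close>
      also have "\<dots> \<le> 153600 * k * X powr (1 - \<eta>) + 120 * X powr (1 - \<eta>)
          + 384 * (64 * X powr (1 - \<eta>) + 24576 * X powr (1 - \<eta>) + 512 * k * X powr (1 - \<eta>) + 196608 * k * X powr (1 - \<eta>))"
        unfolding \<mu>_def using k th eta c by (intro add_mono mult_left_mono mono) auto
      also have "\<dots> = (153600 * k + 120 + 384 * 64 * (1 + 8 * k) + 384 * 24576 * (1 + 8 * k)) * X powr (1 - \<eta>)"
        by (simp add: algebra_simps)
      finally show "real (card (sq_pairs c X (X powr \<theta>)))
          \<le> (153600 * k + 120 + 384 * 64 * (1 + 8 * k) + 384 * 24576 * (1 + 8 * k)) * X powr (1 - \<eta>)"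
        by (simp add: Y_def)
    qed
  qed
  thus ?thesis by blast
qed

section \<open>The remaining range of d and the bound uniform in Y\<close>

lemma sq_pairs_large:
  assumes c: "1 < c" "c < 2" and eta: "0 < \<eta>"
  shows "\<forall>\<^sub>F X in at_top. \<forall>\<theta>. c - 1 + \<eta> \<le> \<theta> \<longrightarrow>
    real (card (sq_pairs c X (X powr \<theta>))) \<le> 8 * X powr (1 - \<eta>)"
  using eventually_ge_at_top[of 1]
proof eventually_elim
  case (elim X)
  show ?case
  proof (intro allI impI)
    fix \<theta> assume th: "c - 1 + \<eta> \<le> \<theta>"
    have "1 \<le> X powr \<theta>" using th c eta elim by (intro ge_one_powr_ge_zero) auto
    hence "real (card (sq_pairs c X (X powr \<theta>))) \<le> 8 * X powr c / X powr \<theta>"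
      using c elim by (intro card_sq_pairs_trivial) auto
    also have "\<dots> = 8 * X powr (c - \<theta>)" by (simp add: powr_diff)
    also have "\<dots> \<le> 8 * X powr (1 - \<eta>)" using th elim by (intro mult_left_mono powr_mono) auto
    finally show "real (card (sq_pairs c X (X powr \<theta>))) \<le> 8 * X powr (1 - \<eta>)" .
  qed
qed

text \<open>\<open>Y\<close> is quantified inside the eventuality, because later it runs through
  dyadic values that depend on the same large parameter.\<close>

theorem card_sq_pairs:
  assumes c: "1 < c" "c < 149 / 87" and "0 < \<epsilon>"
  obtains \<eta> C where "0 < \<eta>" "\<eta> < 1"
    "\<forall>\<^sub>F X in at_top. \<forall>Y\<ge>X powr \<epsilon>. real (card (sq_pairs c X Y)) \<le> C * X powr (1 - \<eta>)"
proof -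
  \<comment> \<open>3/10000 fits the slack at the cut 571/1000 on both sides; \<epsilon> / 6 handles
    the smallest d.\<close>
  define \<eta> where "\<eta> = min (3 / 10000) (\<epsilon> / 6)"
  have eta: "0 < \<eta>" "\<eta> \<le> 3 / 10000" "6 * \<eta> \<le> \<epsilon>" using assms by (auto simp: \<eta>_def)
  have c2: "c < 2" using c by simp
  obtain C1 where C1: "\<forall>\<^sub>F X in at_top. \<forall>\<theta>. \<epsilon> \<le> \<theta> \<and> \<theta> \<le> 571 / 1000 \<longrightarrow>
    real (card (sq_pairs c X (X powr \<theta>))) \<le> C1 * X powr (1 - \<eta>)"
    using sq_pairs_small[OF c eta] by blast
  obtain C2 where C2: "\<forall>\<^sub>F X in at_top. \<forall>\<theta>. 571 / 1000 \<le> \<theta> \<and> \<theta> \<le> c - 1 + \<eta> \<longrightarrow>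
    real (card (sq_pairs c X (X powr \<theta>))) \<le> C2 * X powr (1 - \<eta>)"
    using sq_pairs_medium[OF c eta(1,2)] by blast
  define C where "C = max 8 (max C1 C2)"
  have "\<forall>\<^sub>F X in at_top. \<forall>Y\<ge>X powr \<epsilon>. real (card (sq_pairs c X Y)) \<le> C * X powr (1 - \<eta>)"
    using C1 C2 sq_pairs_large[OF c(1) c2 eta(1)] eventually_ge_at_top[of 2]
  proof eventually_elim
    case (elim X)
    show ?case
    proof (intro allI impI)
      fix Y assume Y: "X powr \<epsilon> \<le> Y"
      have "0 < X powr \<epsilon>" using elim(4) by simp
      hence Y0: "0 < Y" using Y by linarith
      define \<theta> where "\<theta> = log X Y"
      have th: "Y = X powr \<theta>" using Y0 elim(4) by (simp add: \<theta>_def)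
      have "X powr \<epsilon> \<le> X powr \<theta>" using Y th by simp
      hence "\<epsilon> \<le> \<theta>" using elim(4) by simp
      hence "\<exists>C'\<in>{8, C1, C2}. real (card (sq_pairs c X (X powr \<theta>))) \<le> C' * X powr (1 - \<eta>)"
        using elim(1-3) by (cases "\<theta> \<le> 571 / 1000"; cases "\<theta> \<le> c - 1 + \<eta>") auto
      moreover have "\<forall>C'\<in>{8, C1, C2}. C' \<le> C" by (auto simp: C_def)
      ultimately obtain C' where "C' \<le> C" "real (card (sq_pairs c X Y)) \<le> C' * X powr (1 - \<eta>)"
        unfolding th by blast
      moreover from this have "C' * X powr (1 - \<eta>) \<le> C * X powr (1 - \<eta>)" by (intro mult_right_mono) auto
      ultimately show "real (card (sq_pairs c X Y)) \<le> C * X powr (1 - \<eta>)" by linarith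
    qed
  qed
  thus ?thesis using eta(1,2) by (intro that[of \<eta> C]) auto
qed

section \<open>The radical\<close>

text \<open>Halving every multiplicity gives a \<open>d\<close> whose square divides
  \<open>m\<close> and leaves at most one further factor of each prime, so m <= d^2 * rad m; the
  hypothesis forces d < D.\<close>

lemma ln_le_sum_prime_factors:
  fixes m :: nat and D :: real
  assumes m: "0 < m" and D: "1 \<le> D" and sqf: "\<And>d. D \<le> real d \<Longrightarrow> \<not> d\<^sup>2 dvd m"
  shows "ln (real m) - 2 * ln D \<le> (\<Sum>p\<in>prime_factors m. ln (real p))"
proof -
  let ?v = "\<lambda>p. multiplicity p m"
  define d where "d = (\<Prod>p\<in>prime_factors m. p ^ (?v p div 2))"
  define R where "R = (\<Prod>p\<in>prime_factors m. p)"
  have m_eq: "m = (\<Prod>p\<in>prime_factors m. p ^ ?v p)"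
    using prod_prime_factors[of m] m by simp
  have pos: "0 < p" if "p \<in> prime_factors m" for p
    using that prime_gt_0_nat by auto
  have d2: "d\<^sup>2 = (\<Prod>p\<in>prime_factors m. p ^ (2 * (?v p div 2)))"
    unfolding d_def by (simp add: prod_power_distrib mult.commute flip: power_mult)
  have "d\<^sup>2 dvd (\<Prod>p\<in>prime_factors m. p ^ ?v p)"
    unfolding d2 by (intro prod_dvd_prod le_imp_power_dvd) simp
  hence "d\<^sup>2 dvd m" using m_eq by simp
  hence dD: "real d < D" using sqf[of d] by force
  have d1: "1 \<le> d" using pos by (simp add: d_def Suc_leI prod_pos)
  have R1: "1 \<le> R" using pos by (simp add: R_def Suc_leI prod_pos)
  have "m \<le> d\<^sup>2 * R"
  proof -
    have "(\<Prod>p\<in>prime_factors m. p ^ ?v p) \<le> (\<Prod>p\<in>prime_factors m. p ^ (2 * (?v p div 2)) * p)"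
    proof (intro prod_mono conjI)
      fix p assume p: "p \<in> prime_factors m"
      have "p ^ ?v p \<le> p ^ (2 * (?v p div 2) + 1)"
        using pos[OF p] by (intro power_increasing) auto
      thus "p ^ ?v p \<le> p ^ (2 * (?v p div 2)) * p" by (simp add: mult.commute)
    qed simp
    thus ?thesis unfolding d2 R_def prod.distrib using m_eq by simp
  qed
  hence "real m \<le> (real d)\<^sup>2 * real R" by (metis of_nat_le_iff of_nat_mult of_nat_power)
  hence "ln (real m) \<le> ln ((real d)\<^sup>2 * real R)" using m by (intro ln_mono) auto
  also have "\<dots> = 2 * ln (real d) + ln (real R)"
    using d1 R1 by (simp add: ln_mult ln_realpow)
  also have "ln (real d) \<le> ln D" using dD d1 by (intro ln_mono) auto
  also have "ln (real R) = (\<Sum>p\<in>prime_factors m. ln (real p))"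
    unfolding R_def using pos by (simp add: ln_prod)
  finally show ?thesis by simp
qed

text \<open>A prime dividing the positive integer floor of n^c is at most x^c by itself, so after
  the exchange the inner sum runs over all prime factors.\<close>

lemma sum_primes_eq:
  fixes c x :: real
  assumes c: "1 < c"
  defines "N \<equiv> {n::nat. 1 \<le> n \<and> real n \<le> x}"
  shows "(\<Sum>p | prime p \<and> real p \<le> x powr c.
       ln (real p) * (\<Sum>n :: nat | 1 \<le> n \<and> real n \<le> x \<and> int p dvd \<lfloor>real n powr c\<rfloor>. 1))
    = (\<Sum>n\<in>N. \<Sum>p\<in>prime_factors (nat \<lfloor>real n powr c\<rfloor>). ln (real p))"
proof -
  let ?P = "{p::nat. prime p \<and> real p \<le> x powr c}"
  have finP: "finite ?P"
    by (rule finite_subset[of _ "{..nat \<lfloor>x powr c\<rfloor>}"]) (auto simp: le_nat_floor)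
  have finN: "finite N" unfolding N_def
    by (rule finite_subset[of _ "{..nat \<lfloor>x\<rfloor>}"]) (auto simp: le_nat_floor)
  have "(\<Sum>p\<in>?P. ln (real p) * (\<Sum>n :: nat | 1 \<le> n \<and> real n \<le> x \<and> int p dvd \<lfloor>real n powr c\<rfloor>. 1))
      = (\<Sum>p\<in>?P. \<Sum>n | n \<in> N \<and> int p dvd \<lfloor>real n powr c\<rfloor>. ln (real p))"
  proof (intro sum.cong refl)
    fix p
    have "{n. 1 \<le> n \<and> real n \<le> x \<and> int p dvd \<lfloor>real n powr c\<rfloor>} = {n. n \<in> N \<and> int p dvd \<lfloor>real n powr c\<rfloor>}"
      by (auto simp: N_def)
    thus "ln (real p) * (\<Sum>n :: nat | 1 \<le> n \<and> real n \<le> x \<and> int p dvd \<lfloor>real n powr c\<rfloor>. 1)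
      = (\<Sum>n | n \<in> N \<and> int p dvd \<lfloor>real n powr c\<rfloor>. ln (real p))" by simp
  qed
  also have "\<dots> = (\<Sum>n\<in>N. \<Sum>p | p \<in> ?P \<and> int p dvd \<lfloor>real n powr c\<rfloor>. ln (real p))"
    using finP finN by (rule sum.swap_restrict)
  also have "\<dots> = (\<Sum>n\<in>N. \<Sum>p\<in>prime_factors (nat \<lfloor>real n powr c\<rfloor>). ln (real p))"
  proof (intro sum.cong refl)
    fix n assume n: "n \<in> N"
    define m where "m = nat \<lfloor>real n powr c\<rfloor>"
    have "1 \<le> real n powr c" using n c by (intro ge_one_powr_ge_zero) (auto simp: N_def)
    hence m: "0 < m" "\<lfloor>real n powr c\<rfloor> = int m" "real m \<le> real n powr c"
      unfolding m_def by (linarith, linarith, simp)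
    have "real n powr c \<le> x powr c" using n c by (intro powr_mono2) (auto simp: N_def)
    hence mx: "real m \<le> x powr c" using m by linarith
    show "{p. p \<in> ?P \<and> int p dvd \<lfloor>real n powr c\<rfloor>} = prime_factors (nat \<lfloor>real n powr c\<rfloor>)"
      unfolding m(2)
    proof safe
      fix p assume "prime p" "int p dvd int m"
      thus "p \<in> prime_factors (nat (int m))" using m(1) by (simp add: prime_factors_dvd)
    next
      fix p assume p: "p \<in> prime_factors (nat (int m))"
      thus "prime p" by auto
      have "p dvd m" using p by (auto simp: prime_factors_dvd)
      thus "int p dvd int m" by simp
      have "p \<le> m" using \<open>p dvd m\<close> m(1) by (rule dvd_imp_le)
      thus "real p \<le> x powr c" using mx by linarith
    qed
  qed
  finally show ?thesis .
qed

section \<open>Dyadic decomposition and conclusion\<close>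

lemma ex_dyadic_scale:
  fixes t :: real
  assumes "1 \<le> t"
  obtains j :: nat where "2 ^ j \<le> t" "t < 2 * 2 ^ j" "real j \<le> log 2 t"
proof -
  define j where "j = nat \<lfloor>log 2 t\<rfloor>"
  have "0 \<le> log 2 t" using assms by simp
  hence j: "real j \<le> log 2 t" "log 2 t < real j + 1" unfolding j_def by linarith+
  have "2 powr real j \<le> t" using j(1) assms by (simp add: le_log_iff)
  moreover have "t < 2 powr (real j + 1)" using j(2) assms by (simp add: log_less_iff)
  ultimately show ?thesis using j(1) by (intro that[of j]) (auto simp: powr_realpow powr_add)
qed

text \<open>O((log x)^2) dyadic boxes in n and d, each with O(x^(1-eta)) pairs. Values n <= sqrt x
  are discarded first, which keeps every scale X at least sqrt x / 2 and so within reach of the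
  asymptotic bound.\<close>

lemma card_large_square_divisor:
  fixes c \<delta> \<kappa> :: real
  assumes c: "1 < c" "c < 149 / 87" and d: "0 < \<delta>" and k: "0 < \<kappa>"
  shows "\<forall>\<^sub>F x in at_top. real (card {n::nat. 1 \<le> n \<and> real n \<le> x
    \<and> (\<exists>d::nat. x powr \<delta> \<le> real d \<and> d\<^sup>2 dvd nat \<lfloor>real n powr c\<rfloor>)}) \<le> \<kappa> * x"
proof -
  obtain \<eta> C where eta: "0 < \<eta>" "\<eta> < 1"
    and ev: "\<forall>\<^sub>F X in at_top. \<forall>Y\<ge>X powr \<delta>. real (card (sq_pairs c X Y)) \<le> C * X powr (1 - \<eta>)"
    using card_sq_pairs[OF c d] by blast
  obtain X0 where X0: "\<And>X Y. X0 \<le> X \<Longrightarrow> X powr \<delta> \<le> Y \<Longrightarrow> real (card (sq_pairs c X Y)) \<le> C * X powr (1 - \<eta>)"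
    using ev unfolding eventually_at_top_linorder by blast
  define K where "K = \<bar>C\<bar> + 1"
  have K: "0 < K" "C \<le> K" by (simp_all add: K_def)
  have "\<forall>\<^sub>F x in at_top. X0 \<le> sqrt x / 2" "\<forall>\<^sub>F x in at_top. (2 :: real) \<le> x"
    "\<forall>\<^sub>F x in at_top. sqrt x + 1 \<le> \<kappa> / 2 * x"
    "\<forall>\<^sub>F x in at_top. (log 2 x + 2) * (2 * log 2 x + 1) * (K * x powr (1 - \<eta>)) \<le> \<kappa> / 2 * x"
    using eta k K(1) by real_asymp+
  thus ?thesis
  proof eventually_elim
    case (elim x)
    let ?bad = "{n::nat. 1 \<le> n \<and> real n \<le> x \<and> (\<exists>d::nat. x powr \<delta> \<le> real d \<and> d\<^sup>2 dvd nat \<lfloor>real n powr c\<rfloor>)}"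
    define I where "I = {..nat \<lfloor>log 2 x\<rfloor> + 1}"
    define J where "J = {..nat \<lfloor>2 * log 2 x\<rfloor>}"
    define S where "S = (\<lambda>i j::nat. sq_pairs c (x / 2 ^ i) (x powr \<delta> * 2 ^ j))"
    define low where "low = {n::nat. 0 \<le> real n \<and> real n \<le> sqrt x}"
    define I' where "I' = {i \<in> I. sqrt x / 2 \<le> x / 2 ^ i}"
    have lx: "1 \<le> log 2 x" using elim by simp
    have x1: "1 \<le> x powr \<delta>" using elim d by (intro ge_one_powr_ge_zero) auto
    have sub: "?bad \<subseteq> low \<union> (\<Union>i\<in>I'. \<Union>j\<in>J. snd ` S i j)"
    proof
      fix n assume n: "n \<in> ?bad"
      then obtain e :: nat where e: "x powr \<delta> \<le> real e" "e\<^sup>2 dvd nat \<lfloor>real n powr c\<rfloor>" by blast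
      have n1: "1 \<le> real n" "real n \<le> x" using n by auto
      show "n \<in> low \<union> (\<Union>i\<in>I'. \<Union>j\<in>J. snd ` S i j)"
      proof (cases "real n \<le> sqrt x")
        case False
        \<comment> \<open>The scale of 2 x / n, not of x / n, yields X = x / 2^i with X < n <= 2 X;
          therefore \<open>I\<close> reaches one index beyond log 2 x.\<close>
        have "1 \<le> 2 * x / real n" using n1 by (simp add: field_simps)
        then obtain i where i: "2 ^ i \<le> 2 * x / real n" "2 * x / real n < 2 * 2 ^ i" "real i \<le> log 2 (2 * x / real n)"
          by (rule ex_dyadic_scale)
        have ni: "x / 2 ^ i < real n" "real n \<le> 2 * (x / 2 ^ i)"
          using i(1,2) n1 by (auto simp: field_simps)
        have "log 2 (2 * x / real n) \<le> log 2 (2 * x)" using n1 by (simp add: field_simps)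
        hence "real i \<le> 1 + log 2 x" using i(3) elim by (simp add: log_mult)
        hence iI: "i \<in> I" unfolding I_def using lx by (simp, linarith)
        have x0: "0 < x powr \<delta>" using x1 by linarith
        have ge1: "1 \<le> real e / x powr \<delta>" using e(1) by (simp only: le_divide_eq_1_pos[OF x0])
        then obtain j where j: "2 ^ j \<le> real e / x powr \<delta>" "real e / x powr \<delta> < 2 * 2 ^ j" "real j \<le> log 2 (real e / x powr \<delta>)"
          by (rule ex_dyadic_scale)
        have ej: "x powr \<delta> * 2 ^ j \<le> real e" "real e < 2 * (x powr \<delta> * 2 ^ j)"
          using j(1,2) by (simp_all only: pos_le_divide_eq[OF x0] pos_divide_less_eq[OF x0] mult_ac)
        \<comment> \<open>A crude bound, needed only to keep the number of scales for d
          logarithmic.\<close>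
        have "real e \<le> x powr 2"
        proof -
          have "1 \<le> real n powr c" using n1 c by (intro ge_one_powr_ge_zero) auto
          hence m: "0 < nat \<lfloor>real n powr c\<rfloor>" by linarith
          have "e \<le> e\<^sup>2" by (simp add: power2_eq_square)
          also have "e\<^sup>2 \<le> nat \<lfloor>real n powr c\<rfloor>" using e(2) m by (rule dvd_imp_le)
          finally have "real e \<le> real (nat \<lfloor>real n powr c\<rfloor>)" by (simp only: of_nat_le_iff)
          also have "\<dots> \<le> real n powr c" by simp
          also have "\<dots> \<le> x powr c" using n1 c by (intro powr_mono2) auto
          also have "\<dots> \<le> x powr 2" using c elim by (intro powr_mono) auto
          finally show ?thesis .
        qed
        moreover have "real e / x powr \<delta> \<le> real e" 
          using mult_left_mono[OF x1, of "real e"] by (simp add: pos_divide_le_eq[OF x0])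
        ultimately have q: "real e / x powr \<delta> \<le> x powr 2" by linarith
        have "0 < real e / x powr \<delta>" using ge1 by linarith
        from log_mono[OF _ this q, of 2] have "log 2 (real e / x powr \<delta>) \<le> log 2 (x powr 2)" by simp
        moreover have "log 2 (x powr 2) = 2 * log 2 x" by (rule log_powr)
        ultimately have "real j \<le> 2 * log 2 x" using j(3) by linarith
        hence jJ: "j \<in> J" unfolding J_def by (simp add: le_nat_floor)
        have "sqrt x / 2 \<le> x / 2 ^ i" using False ni by linarith
        hence "i \<in> I'" using iI by (simp add: I'_def)
        moreover have "(e, n) \<in> S i j" unfolding S_def sq_pairs_def using ni ej e by auto
        hence "n \<in> snd ` S i j" by force
        ultimately show ?thesis using jJ by blast
      qed (simp add: low_def)
    qed
    have low: "finite low" "real (card low) \<le> sqrt x + 1"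
      using card_nat_Icc_le[of 0 "sqrt x"] elim by (simp_all add: low_def)
    have fin: "finite I'" "finite J" "\<And>i j. finite (S i j)" by (auto simp: I'_def I_def J_def S_def)
    have SC: "real (card (snd ` S i j)) \<le> K * x powr (1 - \<eta>)" if "i \<in> I'" for i j
    proof -
      have "sqrt x / 2 \<le> x / 2 ^ i" using that by (simp only: I'_def mem_Collect_eq)
      hence X: "X0 \<le> x / 2 ^ i" "0 \<le> x / 2 ^ i" using elim(1,2) by (linarith, simp)
      have "1 * x \<le> 2 ^ i * x" using elim by (intro mult_right_mono) auto
      hence Xx: "x / 2 ^ i \<le> x" by (simp add: divide_le_eq mult.commute)
      \<comment> \<open>The lower limit for d is a power of x, while the bound asks for a power of
        the smaller X.\<close>
      have "(x / 2 ^ i) powr \<delta> \<le> x powr \<delta>" using X Xx d by (intro powr_mono2) auto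
      also have "\<dots> \<le> x powr \<delta> * 2 ^ j" by (simp add: mult_le_cancel_left1)
      finally have Y: "(x / 2 ^ i) powr \<delta> \<le> x powr \<delta> * 2 ^ j" .
      have "real (card (snd ` S i j)) \<le> real (card (S i j))" using fin by (simp add: card_image_le)
      also have "\<dots> \<le> C * (x / 2 ^ i) powr (1 - \<eta>)" unfolding S_def by (rule X0[OF X(1) Y])
      also have "\<dots> \<le> K * (x / 2 ^ i) powr (1 - \<eta>)" using K by (intro mult_right_mono) auto
      also have "\<dots> \<le> K * x powr (1 - \<eta>)" using X Xx eta K by (intro mult_left_mono powr_mono2) auto
      finally show ?thesis .
    qed
    have "card ?bad \<le> card (low \<union> (\<Union>i\<in>I'. \<Union>j\<in>J. snd ` S i j))"
      using sub low fin by (intro card_mono) auto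
    also have "\<dots> \<le> card low + card (\<Union>i\<in>I'. \<Union>j\<in>J. snd ` S i j)" by (rule card_Un_le)
    also have "card (\<Union>i\<in>I'. \<Union>j\<in>J. snd ` S i j) \<le> (\<Sum>i\<in>I'. \<Sum>j\<in>J. card (snd ` S i j))"
      by (rule order.trans[OF card_UN_le[OF fin(1)] sum_mono[OF card_UN_le[OF fin(2)]]])
    finally have "real (card ?bad) \<le> real (card low) + (\<Sum>i\<in>I'. \<Sum>j\<in>J. real (card (snd ` S i j)))"
      by (simp flip: of_nat_sum of_nat_add)
    also have "\<dots> \<le> (sqrt x + 1) + (\<Sum>i\<in>I'. \<Sum>j\<in>J. K * x powr (1 - \<eta>))"
      using low SC by (intro add_mono sum_mono) auto
    also have "(\<Sum>i\<in>I'. \<Sum>j\<in>J. K * x powr (1 - \<eta>)) = (real (card I') * real (card J)) * (K * x powr (1 - \<eta>))"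
      by simp
    also have "\<dots> \<le> ((log 2 x + 2) * (2 * log 2 x + 1)) * (K * x powr (1 - \<eta>))"
    proof (intro mult_right_mono mult_mono)
      have "card I' \<le> card I" unfolding I'_def by (intro card_mono) (auto simp: I_def)
      hence "real (card I') \<le> real (nat \<lfloor>log 2 x\<rfloor>) + 2" unfolding I_def by simp
      thus "real (card I') \<le> log 2 x + 2" using lx by linarith
      have "real (card J) = real (nat \<lfloor>2 * log 2 x\<rfloor>) + 1" by (simp add: J_def)
      thus "real (card J) \<le> 2 * log 2 x + 1" using lx by linarith
    qed (use lx K in auto)
    finally show ?case using elim(3,4) by linarith
  qed
qed

theorem theorem5:
  fixes c \<epsilon> :: real
  assumes "1 < c" and "c < 149 / 87" and "\<epsilon> > 0"
  shows "\<forall>\<^sub>F x :: real in at_top.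
    (\<Sum>p | prime p \<and> real p \<le> x powr c.
       ln (real p) *
       (\<Sum>n :: nat | 1 \<le> n \<and> real n \<le> x \<and> int p dvd \<lfloor>real n powr c\<rfloor>. 1))
    > (c - \<epsilon>) * x * ln x"
proof -
  \<comment> \<open>The final loss is below 5 \<delta> + 2 c \<delta> <= 9 \<delta>, hence
    \<epsilon> / 10; the cap 1/10 keeps c - 5 \<delta> positive.\<close>
  define \<delta> where "\<delta> = min (\<epsilon> / 10) (1 / 10)"
  have d: "0 < \<delta>" "\<delta> \<le> \<epsilon> / 10" "\<delta> \<le> 1 / 10" using assms by (auto simp: \<delta>_def)
  have "\<forall>\<^sub>F x in at_top. (1 - 2 * \<delta>) * x \<le> x - 1 - (x powr (1 - \<delta>) + 1) - \<delta> * x"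
    "\<forall>\<^sub>F x in at_top. (2 :: real) \<le> x" "\<forall>\<^sub>F x in at_top. ln 2 \<le> \<delta> * ln x"
    "\<forall>\<^sub>F x in at_top. 2 \<le> x powr (1 - \<delta>)"
    using d by real_asymp+
  with card_large_square_divisor[OF assms(1,2) d(1) d(1)]
  show ?thesis
  proof eventually_elim
    case (elim x)
    define N where "N = {n::nat. 1 \<le> n \<and> real n \<le> x}"
    define bad where "bad = {n::nat. 1 \<le> n \<and> real n \<le> x \<and> (\<exists>d::nat. x powr \<delta> \<le> real d \<and> d\<^sup>2 dvd nat \<lfloor>real n powr c\<rfloor>)}"
    \<comment> \<open>Outside \<open>low\<close>, ln n is at least (1 - \<delta>) ln x.\<close>
    define low where "low = {n::nat. 0 \<le> real n \<and> real n \<le> x powr (1 - \<delta>)}"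
    define G where "G = N - bad - low"
    define f where "f = (\<lambda>n. \<Sum>p\<in>prime_factors (nat \<lfloor>real n powr c\<rfloor>). ln (real p))"
    have x2: "2 \<le> x" "0 < ln x" using elim by auto
    have finN: "finite N" unfolding N_def
      by (rule finite_subset[of _ "{..nat \<lfloor>x\<rfloor>}"]) (auto simp: le_nat_floor)
    have f0: "0 \<le> f n" for n
      unfolding f_def by (intro sum_nonneg ln_ge_zero) (auto dest!: in_prime_factors_imp_prime prime_ge_1_nat)
    have low: "finite low" "real (card low) \<le> x powr (1 - \<delta>) + 1"
      using card_nat_Icc_le[of 0 "x powr (1 - \<delta>)"] by (simp_all add: low_def)
    have cardN: "x - 1 \<le> real (card N)"
    proof -
      have "{1..nat \<lfloor>x\<rfloor>} \<subseteq> N" using x2 by (auto simp: N_def) linarith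
      hence "card {1..nat \<lfloor>x\<rfloor>} \<le> card N" using finN by (intro card_mono)
      hence "nat \<lfloor>x\<rfloor> \<le> card N" by simp
      thus ?thesis using x2 by linarith
    qed
    have "card N \<le> card (G \<union> (bad \<union> low))"
      using finN low by (intro card_mono) (auto simp: G_def bad_def N_def intro: finite_subset[OF _ finN])
    also have "\<dots> \<le> card G + (card bad + card low)"
      by (intro order.trans[OF card_Un_le] add_left_mono card_Un_le)
    finally have "real (card N) \<le> real (card G) + (real (card bad) + real (card low))" by linarith
    moreover have "real (card bad) \<le> \<delta> * x" using elim(1) by (simp add: bad_def)
    ultimately have cardG: "(1 - 2 * \<delta>) * x \<le> real (card G)" using cardN low elim by linarith
    \<comment> \<open>The 5 \<delta> are c \<delta> <= 2 \<delta> from the size of n, 2 \<delta>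
      from the square part, and \<delta> for the ln 2 lost in the floor.\<close>
    have fG: "(c - 5 * \<delta>) * ln x \<le> f n" if n: "n \<in> G" for n
    proof -
      define m where "m = nat \<lfloor>real n powr c\<rfloor>"
      have n1: "1 \<le> n" "x powr (1 - \<delta>) \<le> real n" using n by (auto simp: G_def N_def low_def)
      have sqf: "\<not> d\<^sup>2 dvd m" if "x powr \<delta> \<le> real d" for d
        using n that by (auto simp: G_def N_def bad_def m_def)
      have "2 \<le> x powr (1 - \<delta>)" using elim by simp
      hence n2: "2 \<le> real n" using n1 by linarith
      have "real n powr 1 \<le> real n powr c" using n2 assms by (intro powr_mono) auto
      hence nc: "2 \<le> real n powr c" using n2 by simp
      hence m: "0 < m" "real n powr c / 2 \<le> real m" unfolding m_def by linarith+
      have "c * ((1 - \<delta>) * ln x) - ln 2 = ln ((x powr (1 - \<delta>)) powr c / 2)"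
        using x2 by (simp add: ln_div ln_powr)
      also have "\<dots> \<le> ln (real n powr c / 2)"
        using n1 x2 assms by (intro ln_mono divide_right_mono powr_mono2) auto
      also have "\<dots> \<le> ln (real m)" using m nc n1 by (intro ln_mono) auto
      finally have "c * ((1 - \<delta>) * ln x) - ln 2 \<le> ln (real m)" .
      moreover have "1 \<le> x powr \<delta>" using x2 d by (intro ge_one_powr_ge_zero) auto
      hence "ln (real m) - 2 * ln (x powr \<delta>) \<le> f n"
        unfolding f_def m_def[symmetric] using m sqf by (intro ln_le_sum_prime_factors) auto
      ultimately have "c * ((1 - \<delta>) * ln x) - ln 2 - 2 * (\<delta> * ln x) \<le> f n"
        using x2 by (simp add: ln_powr)
      moreover have "c * (\<delta> * ln x) \<le> 2 * (\<delta> * ln x)"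
        using assms d x2 by (intro mult_right_mono) auto
      moreover have "c * ((1 - \<delta>) * ln x) = c * ln x - c * (\<delta> * ln x)" by (simp add: algebra_simps)
      moreover have "(c - 5 * \<delta>) * ln x = c * ln x - 5 * (\<delta> * ln x)" by (simp add: algebra_simps)
      ultimately show ?thesis using elim by linarith
    qed
    have "c - \<epsilon> < (1 - 2 * \<delta>) * (c - 5 * \<delta>)"
    proof -
      have "c * \<delta> \<le> 2 * \<delta>" using assms d by (intro mult_right_mono) auto
      moreover have "0 < \<delta> * \<delta>" using d by simp
      moreover have "(1 - 2 * \<delta>) * (c - 5 * \<delta>) = c - 5 * \<delta> - 2 * (c * \<delta>) + 10 * (\<delta> * \<delta>)"
        by (simp add: algebra_simps)
      ultimately show ?thesis using d by linarith
    qed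
    hence "(c - \<epsilon>) * (x * ln x) < (1 - 2 * \<delta>) * (c - 5 * \<delta>) * (x * ln x)"
      using x2 by (intro mult_strict_right_mono) auto
    also have "\<dots> = (1 - 2 * \<delta>) * x * ((c - 5 * \<delta>) * ln x)" by simp
    also have "\<dots> \<le> real (card G) * ((c - 5 * \<delta>) * ln x)"
      using cardG assms d x2 by (intro mult_right_mono) auto
    also have "\<dots> = (\<Sum>n\<in>G. (c - 5 * \<delta>) * ln x)" by simp
    also have "\<dots> \<le> (\<Sum>n\<in>G. f n)" by (intro sum_mono fG)
    also have "\<dots> \<le> (\<Sum>n\<in>N. f n)" using finN f0 by (intro sum_mono2) (auto simp: G_def)
    also have "\<dots> = (\<Sum>p | prime p \<and> real p \<le> x powr c.
       ln (real p) * (\<Sum>n :: nat | 1 \<le> n \<and> real n \<le> x \<and> int p dvd \<lfloor>real n powr c\<rfloor>. 1))"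
      unfolding sum_primes_eq[OF assms(1)] N_def f_def ..
    finally show ?case by (simp only: mult.assoc)
  qed
qed

end
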